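(* Any non-flat rotationally symmetric, connected semi-quadratic Weingarten surface with $\Lambda_2>0$ is the image under a composition of homotheties, parallel translations and reciprocal transformations of a Weingarten surface (of revolution) satisfying a relation $k_2=\lambda k_1$ with $\lambda\in\mathbb{R}$ constant, where $\lambda<0$ when the given surface is elliptic and $\lambda>0$ when the given surface is hyperbolic.
   Context: Surfaces are $C^2$-smooth oriented surfaces of revolution about the $z$-axis in $\mathbb{R}^3$ (images under the transformations below may be non-regular, i.e. have points where a radius of curvature vanishes). $k_1,k_2$ denote the principal curvatures along the parallels and along the profile curves respectively, $r_i=1/k_i$ the radii of curvature. A surface is non-flat if its Gauss curvature $K=k_1k_2$ is nonzero at every point. A semi-quadratic Weingarten surface is one satisfying $\alpha k_1k_2+\beta k_1+\gamma k_2+\delta=0$ for fixed real $\alpha,\beta,\gamma,\delta$. Put $\Lambda_1=\beta-\gamma$, $\Lambda_2=(\beta+\gamma)^2-4\alpha\delta$. The surface is called elliptic if $\Lambda_2>\Lambda_1^2$ and hyperbolic if $\Lambda_2<\Lambda_1^2$. Let $\theta$ be the angle between the oriented unit normal and the positive $z$-axis and $(\rho(\theta),h(\theta))$ the profile curve parametrised by $\theta$ ($\rho$ the signed distance from the axis, $h$ the height), so that $\rho=r_1\sin\theta$ and $dh/d\theta=-r_2\sin\theta$. A parallel translation moves every point of the surface a fixed distance $v\in\mathbb{R}$ along the oriented unit normal; a homothety is a dilation of $\mathbb{R}^3$. A reciprocal transformation, for a constant $\mathcal{A}\in\mathbb{R}\setminus\{0\}$, sends a surface of revolution to a surface of revolution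 with radii of curvature $(\widetilde r_1,\widetilde r_2)=(-1/r_1,-1/r_2)$ at corresponding points and with Gauss angle $\widetilde\theta$ and distance from the axis $\widetilde\rho$ satisfying $\sin\widetilde\theta=\mathcal{A}\rho(\theta)$, $\widetilde\rho(\widetilde\theta)=-\mathcal{A}\sin\theta$ (the height being determined up to a constant by $d\widetilde h/d\widetilde\theta=-\widetilde r_2\sin\widetilde\theta$). *)

theory Defs
  imports "HOL-Analysis.Analysis"
begin

text \<open>
  A surface of revolution about the z-axis is given by its profile curve
  \<open>(rho, hgt)\<close> over an interval \<open>pdom\<close>, with the angle \<open>ang\<close> from the positive z-axis to the
  oriented unit normal, which is \<open>(sin ang, cos ang)\<close> in the half-plane coordinates.
  \<open>spd\<close> and \<open>trn\<close> are the signed speed of the profile curve and the derivative of \<open>ang\<close>.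
  The parameter is not assumed to be \<open>ang\<close>, since \<open>ang\<close> is stationary where \<open>k\<^sub>2 = 0\<close>
  (planes, cones).
\<close>

record profile =
  pdom :: "real set"
  rho :: "real \<Rightarrow> real"
  hgt :: "real \<Rightarrow> real"
  ang :: "real \<Rightarrow> real"
  spd :: "real \<Rightarrow> real"
  trn :: "real \<Rightarrow> real"

text \<open>
  Surfaces of revolution that need not be regular. A radius of curvature may vanish, but the curve
  \<open>(rho, hgt, ang)\<close> of points with normals is immersed. Eliminating the parameter gives
  \<open>d rho / d ang = r\<^sub>2 cos ang\<close> and \<open>d hgt / d ang = - r\<^sub>2 sin ang\<close> with \<open>r\<^sub>2 = spd / trn\<close>.
  The orbit space of a connected surface of revolution is a one-manifold whose poles are boundary
  points, hence the last condition: the normal line is the axis only at end points.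
  A closed profile curve is covered by its periodic parametrisation.
\<close>

definition gen_surface :: "profile \<Rightarrow> bool" where
  "gen_surface S \<longleftrightarrow>
     is_interval (pdom S) \<and> (\<exists>a\<in>pdom S. \<exists>b\<in>pdom S. a < b) \<and>
     continuous_on (pdom S) (spd S) \<and> continuous_on (pdom S) (trn S) \<and>
     (\<forall>t\<in>pdom S.
        (rho S has_real_derivative spd S t * cos (ang S t)) (at t within pdom S) \<and>
        (hgt S has_real_derivative - (spd S t * sin (ang S t))) (at t within pdom S) \<and>
        (ang S has_real_derivative trn S t) (at t within pdom S) \<and>
        (spd S t, trn S t) \<noteq> (0, 0)) \<and>
     (\<forall>t\<in>interior (pdom S). (rho S t, sin (ang S t)) \<noteq> (0, 0))"

text \<open>
  Radii of curvature as points of the real projective line: the pair \<open>(a, b) \<noteq> (0, 0)\<close> stands for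
  the radius \<open>a / b\<close>, infinite if \<open>b = 0\<close>. The first comes from \<open>rho = r\<^sub>1 sin ang\<close>; at a pole
  both sides vanish, and \<open>r\<^sub>1\<close> takes its limit value, which is \<open>r\<^sub>2\<close>.
\<close>

definition radius2 :: "profile \<Rightarrow> real \<Rightarrow> real \<times> real" where
  "radius2 S t = (spd S t, trn S t)"

definition radius1 :: "profile \<Rightarrow> real \<Rightarrow> real \<times> real" where
  "radius1 S t =
     (if rho S t = 0 \<and> sin (ang S t) = 0 then radius2 S t else (rho S t, sin (ang S t)))"

definition curv1 :: "profile \<Rightarrow> real \<Rightarrow> real" where
  "curv1 S t = snd (radius1 S t) / fst (radius1 S t)"

definition curv2 :: "profile \<Rightarrow> real \<Rightarrow> real" where
  "curv2 S t = snd (radius2 S t) / fst (radius2 S t)"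

text \<open>
  \<open>C\<^sup>2\<close>-smooth surfaces: no radius of curvature vanishes. Then the profile curve is immersed, is
  \<open>C\<^sup>2\<close> in arc length (its tangent angle is \<open>C\<^sup>1\<close>), and meets the axis only orthogonally.
\<close>

definition surface_of_revolution :: "profile \<Rightarrow> bool" where
  "surface_of_revolution S \<longleftrightarrow>
     gen_surface S \<and> (\<forall>t\<in>pdom S. fst (radius1 S t) \<noteq> 0 \<and> fst (radius2 S t) \<noteq> 0)"

definition non_flat :: "profile \<Rightarrow> bool" where
  "non_flat S \<longleftrightarrow> (\<forall>t\<in>pdom S. curv1 S t * curv2 S t \<noteq> 0)"

definition semi_quadratic :: "real \<Rightarrow> real \<Rightarrow> real \<Rightarrow> real \<Rightarrow> profile \<Rightarrow> bool" where
  "semi_quadratic \<alpha> \<beta> \<gamma> \<delta> S \<longleftrightarrow>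
     (\<forall>t\<in>pdom S. \<alpha> * curv1 S t * curv2 S t + \<beta> * curv1 S t + \<gamma> * curv2 S t + \<delta> = 0)"

definition Lambda1 :: "real \<Rightarrow> real \<Rightarrow> real" where
  "Lambda1 \<beta> \<gamma> = \<beta> - \<gamma>"

definition Lambda2 :: "real \<Rightarrow> real \<Rightarrow> real \<Rightarrow> real \<Rightarrow> real" where
  "Lambda2 \<alpha> \<beta> \<gamma> \<delta> = (\<beta> + \<gamma>)\<^sup>2 - 4 * \<alpha> * \<delta>"

definition elliptic :: "real \<Rightarrow> real \<Rightarrow> real \<Rightarrow> real \<Rightarrow> bool" where
  "elliptic \<alpha> \<beta> \<gamma> \<delta> \<longleftrightarrow> Lambda2 \<alpha> \<beta> \<gamma> \<delta> > (Lambda1 \<beta> \<gamma>)\<^sup>2"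

definition hyperbolic :: "real \<Rightarrow> real \<Rightarrow> real \<Rightarrow> real \<Rightarrow> bool" where
  "hyperbolic \<alpha> \<beta> \<gamma> \<delta> \<longleftrightarrow> Lambda2 \<alpha> \<beta> \<gamma> \<delta> < (Lambda1 \<beta> \<gamma>)\<^sup>2"

text \<open>
  In the following relations the second surface is the image of the first. The fields \<open>spd\<close> and
  \<open>trn\<close> of the image are fixed by \<open>gen_surface\<close>, as derivatives are unique. The centre of a
  homothety has to lie on the axis, at height \<open>z\<close>.
\<close>

definition homothety :: "real \<Rightarrow> real \<Rightarrow> profile \<Rightarrow> profile \<Rightarrow> bool" where
  "homothety c z S S' \<longleftrightarrow> pdom S' = pdom S \<and>
     (\<forall>t\<in>pdom S. rho S' t = c * rho S t \<and> hgt S' t = z + c * (hgt S t - z) \<and> ang S' t = ang S t)"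

definition parallel_translation :: "real \<Rightarrow> profile \<Rightarrow> profile \<Rightarrow> bool" where
  "parallel_translation v S S' \<longleftrightarrow> pdom S' = pdom S \<and>
     (\<forall>t\<in>pdom S. rho S' t = rho S t + v * sin (ang S t) \<and>
                 hgt S' t = hgt S t + v * cos (ang S t) \<and> ang S' t = ang S t)"

text \<open>
  The map \<open>\<phi>\<close> sends a point of the image to the point it comes from. It need not be injective:
  \<open>sin ang'\<close> determines \<open>ang'\<close> only up to the reflection at the right angle, so a boundary
  circle of \<open>S\<close> with \<open>\<bar>A * rho\<bar> = 1\<close> becomes an equator of \<open>S'\<close>, and the two sides of that equator
  both come from the same side in \<open>S\<close>. The last condition is \<open>r' = - 1 / r\<close> for both
  radii. The height of \<open>S'\<close> is left free up to the constant allowed by \<open>gen_surface S'\<close>.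
\<close>

definition reciprocal :: "real \<Rightarrow> profile \<Rightarrow> profile \<Rightarrow> bool" where
  "reciprocal A S S' \<longleftrightarrow>
     (\<exists>\<phi>. continuous_on (pdom S') \<phi> \<and> \<phi> ` pdom S' = pdom S \<and>
        (\<forall>t\<in>pdom S'.
           sin (ang S' t) = A * rho S (\<phi> t) \<and> rho S' t = - A * sin (ang S (\<phi> t)) \<and>
           (\<forall>r\<in>{radius1, radius2}.
              fst (r S' t) * fst (r S (\<phi> t)) = - (snd (r S' t) * snd (r S (\<phi> t))))))"

definition elementary :: "profile \<Rightarrow> profile \<Rightarrow> bool" where
  "elementary S S' \<longleftrightarrow> gen_surface S \<and> gen_surface S' \<and>
     ((\<exists>c z. c > 0 \<and> homothety c z S S') \<or>
      (\<exists>v. parallel_translation v S S') \<or>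
      (\<exists>A. A \<noteq> 0 \<and> reciprocal A S S'))"

definition image_under_composition :: "profile \<Rightarrow> profile \<Rightarrow> bool" where
  "image_under_composition T S \<longleftrightarrow> elementary\<^sup>*\<^sup>* T S"

end

theory Submission
  imports Defs
begin

text \<open>
  In the plane of the pair \<open>(rho, sin ang)\<close> all the transformations act linearly, generating
  \<open>SL\<^sub>2\<close> and the positive dilations, and they act in the same way on \<open>(spd, trn)\<close>. The Weingarten
  relation is a bilinear form in the two vectors. For \<open>\<Lambda>\<^sub>2 > 0\<close> it becomes antidiagonal in
  suitable linear coordinates \<open>(u, w)\<close>, which is the relation \<open>k\<^sub>2 = lam * k\<^sub>1\<close>, and it forces
  \<open>(rho, sin ang)\<close> to run along a curve \<open>u = C * \<bar>w\<bar> powr lam\<close>. So the surface \<open>T\<close> has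
  \<open>rho\<close> proportional to \<open>w\<close> and \<open>sin ang\<close> proportional to \<open>u\<close>, with a factor small enough to
  give a sine. This needs \<open>rho S\<close> to be bounded, which can fail only if \<open>u\<close> or \<open>w\<close> is a
  multiple of \<open>sin ang\<close>; then a parallel translation alone is enough. One reciprocal
  transformation between two parallel translations suffices otherwise. Exchanging \<open>u\<close> and \<open>w\<close>
  replaces \<open>lam\<close> by its inverse, so one may assume \<open>lam < 0\<close> or \<open>lam > 1\<close>; in the latter case
  this makes the curve smooth at the poles \<open>u = w = 0\<close>.
\<close>

section \<open>Functions on intervals\<close>

text \<open>\<open>I\<close> need not be closed or bounded, so each point gets a compact subinterval
  \<open>{a..b}\<close> that is a neighbourhood of it relative to \<open>I\<close>; there the
  fundamental theorem applies.\<close>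

lemma continuous_primitive_interval:
  fixes f :: "real \<Rightarrow> real"
  assumes I: "is_interval I" and f: "continuous_on I f"
  obtains F where "\<And>x. x \<in> I \<Longrightarrow> (F has_real_derivative f x) (at x within I)"
proof (cases "I = {}")
  case False
  then obtain c where c: "c \<in> I" by blast
  \<comment> \<open>At least one of the two integrals vanishes, so this is the signed integral from
    \<open>c\<close> to \<open>x\<close>.\<close>
  define F where "F x = integral {c..x} f - integral {x..c} f" for x
  have "(F has_real_derivative f x) (at x within I)" if x: "x \<in> I" for x
  proof -
    obtain a where a: "a \<in> I" "a \<le> x" "a \<le> c" "a < x \<or> (\<forall>y\<in>I. x \<le> y)"
    proof (cases "\<exists>y\<in>I. y < x")
      case True
      then obtain y where "y \<in> I" "y < x" by blast
      then show ?thesis using that[of "min y c"] c by (auto simp: min_def)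
    next
      case False
      then show ?thesis using that[of x] x c by (force simp: not_less)
    qed
    obtain b where b: "b \<in> I" "x \<le> b" "c \<le> b" "x < b \<or> (\<forall>y\<in>I. y \<le> x)"
    proof (cases "\<exists>y\<in>I. x < y")
      case True
      then obtain y where "y \<in> I" "x < y" by blast
      then show ?thesis using that[of "max y c"] c by (auto simp: max_def)
    next
      case False
      then show ?thesis using that[of x] x c by (force simp: not_less)
    qed
    have sub: "{a..b} \<subseteq> I"
      using mem_is_interval_1_I[OF I a(1) b(1)] by auto
    have int: "f integrable_on {y..z}" if "a \<le> y" "z \<le> b" for y z
      by (rule integrable_continuous_real[OF continuous_on_subset[OF f]]) (use that sub in auto)
    have F_eq: "F y = integral {a..y} f - integral {a..c} f" if "y \<in> {a..b}" for y
    proof (cases "y \<le> c")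
      case True
      then have "integral {a..y} f + integral {y..c} f = integral {a..c} f"
        using that b by (intro Henstock_Kurzweil_Integration.integral_combine int) auto
      moreover have "integral {c..y} f = 0"
        using True by (cases "y = c") auto
      ultimately show ?thesis by (simp add: F_def)
    next
      case False
      then have "integral {a..c} f + integral {c..y} f = integral {a..y} f"
        using that a by (intro Henstock_Kurzweil_Integration.integral_combine int) auto
      with False show ?thesis by (simp add: F_def)
    qed
    have "((\<lambda>y. integral {a..y} f) has_real_derivative f x) (at x within {a..b})"
      using integral_has_real_derivative[of a b f x] sub f a b
      by (auto intro: continuous_on_subset)
    then have "((\<lambda>y. integral {a..y} f - integral {a..c} f) has_real_derivative f x)
        (at x within {a..b})"
      by (auto intro!: derivative_eq_intros)
    then have "(F has_real_derivative f x) (at x within {a..b})"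
      using a b by (subst has_field_derivative_cong_eventually[where g =
          "\<lambda>y. integral {a..y} f - integral {a..c} f"])
        (auto simp: F_eq eventually_at_filter)
    moreover have "at x within {a..b} = at x within I"
    proof (rule at_within_nhd)
      \<comment> \<open>\<open>a = x\<close> occurs only if \<open>x\<close> is the minimum of
        \<open>I\<close>; reaching down to \<open>x - 1\<close> then adds no point of
        \<open>I\<close>. The right end is alike.\<close>
      define l where "l = (if a < x then a else x - 1)"
      define r where "r = (if x < b then b else x + 1)"
      show "x \<in> {l<..<r}" "open {l<..<r}" by (auto simp: l_def r_def)
      show "{a..b} \<inter> {l<..<r} - {x} = I \<inter> {l<..<r} - {x}"
        using a b sub by (auto simp: l_def r_def split: if_splits intro: order.antisym)
    qed
    ultimately show ?thesis by simp
  qed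
  then show ?thesis using that by blast
qed (use that in auto)

lemma continuous_nonzero_sign:
  fixes f :: "real \<Rightarrow> real"
  assumes "is_interval I" "continuous_on I f" "\<And>x. x \<in> I \<Longrightarrow> f x \<noteq> 0"
  shows "(\<forall>x\<in>I. 0 < f x) \<or> (\<forall>x\<in>I. f x < 0)"
proof (rule ccontr)
  assume "\<not> ?thesis"
  then obtain x y where "x \<in> I" "y \<in> I" "f x \<le> 0" "0 \<le> f y" by force
  moreover have "is_interval (f ` I)"
    using assms by (simp add: is_interval_connected_1 connected_continuous_image)
  ultimately have "0 \<in> f ` I" unfolding is_interval_1 by blast
  with assms(3) show False by auto
qed

text \<open>A nondegenerate interval lies in the closure of its interior, and the zeros of
  \<open>f - g\<close> are relatively closed. This carries identities to the end points, where poles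
  may sit.\<close>

lemma eq_on_interior_imp_eq:
  fixes f g :: "real \<Rightarrow> real"
  assumes I: "is_interval I" "a \<in> I" "b \<in> I" "a < b"
    and c: "continuous_on I f" "continuous_on I g"
    and eq: "\<And>x. x \<in> interior I \<Longrightarrow> f x = g x"
    and x: "x \<in> I"
  shows "f x = g x"
proof -
  have "{a<..<b} \<subseteq> I" using mem_is_interval_1_I[OF I(1-3)] by auto
  then have "{a<..<b} \<subseteq> interior I" by (intro interior_maximal) auto
  moreover have "(a + b) / 2 \<in> {a<..<b}" using I by simp
  ultimately have "interior I \<noteq> {}" by blast
  then have cl: "closure (interior I) = closure I"
    using I by (intro convex_closure_interior) (auto simp: is_interval_convex)
  have "continuous_on I (\<lambda>x. f x - g x)" using c by (intro continuous_intros)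
  then obtain K where K: "closed K" "K \<inter> I = (\<lambda>x. f x - g x) -` {0} \<inter> I"
    using continuous_on_closed_invariant[of I "\<lambda>x. f x - g x"] closed_singleton by blast
  have "interior I \<subseteq> K" using K eq interior_subset[of I] by fastforce
  then have "closure (interior I) \<subseteq> K" using K by (simp add: closure_minimal)
  with cl x have "x \<in> K" using closure_subset[of I] by auto
  with x K show ?thesis by auto
qed

lemma linear_ode_solution:
  fixes y :: "real \<Rightarrow> real"
  assumes I: "is_interval I"
    and F: "\<And>x. x \<in> I \<Longrightarrow> (F has_real_derivative f x) (at x within I)"
    and y: "\<And>x. x \<in> I \<Longrightarrow> (y has_real_derivative k * f x * y x) (at x within I)"
  obtains c where "\<And>x. x \<in> I \<Longrightarrow> y x = c * exp (k * F x)"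
proof -
  have "((\<lambda>x. y x * exp (- k * F x)) has_real_derivative 0) (at x within I)" if "x \<in> I" for x
    by (rule derivative_eq_intros F[OF that] y[OF that] refl)+ (simp add: algebra_simps)
  then obtain c where c: "\<And>x. x \<in> I \<Longrightarrow> y x * exp (- k * F x) = c"
    using has_field_derivative_zero_constant[OF is_interval_convex[OF I],
        of "\<lambda>x. y x * exp (- k * F x)"] by blast
  have "y x = c * exp (k * F x)" if "x \<in> I" for x
    using c[OF that] by (simp add: exp_minus field_simps)
  with that show ?thesis by blast
qed

text \<open>At zero the difference quotient is \<open>y powr (k - 1)\<close>, which tends to 0 for
  \<open>1 < k\<close>; by the convention \<open>0 powr a = 0\<close> this is the stated value. It
  matters where the curve starts at a pole.\<close>

lemma powr_has_derivative_nonneg: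
  fixes x k :: real
  assumes "0 \<le> x" "x = 0 \<Longrightarrow> 1 < k"
  shows "((\<lambda>x. x powr k) has_real_derivative k * x powr (k - 1)) (at x within {0..})"
proof (cases "x = 0")
  case False
  then show ?thesis
    using assms by (auto intro!: has_field_derivative_at_within has_real_derivative_powr)
next
  case True
  then have k: "1 < k" using assms by simp
  have "continuous_on {0..} (\<lambda>y::real. y powr (k - 1))"
    using k by (intro continuous_on_powr' continuous_intros) auto
  then have "((\<lambda>y. y powr (k - 1)) \<longlongrightarrow> 0) (at 0 within {0..})"
    using k by (force simp: continuous_on_def)
  moreover have "\<forall>\<^sub>F y in at 0 within {0..}. y powr (k - 1) = (y powr k - 0 powr k) / (y - 0)"
    by (auto simp: eventually_at_filter powr_diff)
  ultimately show ?thesis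
    unfolding True has_field_derivative_iff by (simp add: tendsto_cong)
qed

section \<open>Surfaces of revolution and their transformations\<close>

definition lin :: "real \<Rightarrow> real \<Rightarrow> profile \<Rightarrow> real \<Rightarrow> real" where
  "lin a b S t = a * rho S t + b * sin (ang S t)"

definition dlin :: "real \<Rightarrow> real \<Rightarrow> profile \<Rightarrow> real \<Rightarrow> real" where
  "dlin a b S t = a * spd S t + b * trn S t"

lemma gen_surfaceD:
  assumes "gen_surface S"
  shows "is_interval (pdom S)" "\<exists>a\<in>pdom S. \<exists>b\<in>pdom S. a < b"
    "continuous_on (pdom S) (spd S)" "continuous_on (pdom S) (trn S)"
    "t \<in> pdom S \<Longrightarrow> (rho S has_real_derivative spd S t * cos (ang S t)) (at t within pdom S)"
    "t \<in> pdom S \<Longrightarrow> (hgt S has_real_derivative - (spd S t * sin (ang S t))) (at t within pdom S)"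
    "t \<in> pdom S \<Longrightarrow> (ang S has_real_derivative trn S t) (at t within pdom S)"
    "t \<in> pdom S \<Longrightarrow> (spd S t, trn S t) \<noteq> (0, 0)"
    "t \<in> interior (pdom S) \<Longrightarrow> (rho S t, sin (ang S t)) \<noteq> (0, 0)"
  using assms unfolding gen_surface_def by blast+

lemma gen_surface_continuous:
  assumes "gen_surface S"
  shows "continuous_on (pdom S) (rho S)" "continuous_on (pdom S) (ang S)"
  unfolding continuous_on_eq_continuous_within
  by (blast intro: DERIV_continuous gen_surfaceD[OF assms])+

text \<open>The vector \<open>(rho, sin ang)\<close> has velocity \<open>cos ang\<close> times
  \<open>(spd, trn)\<close>, so one linear form evaluated on both gives a function and, up to the
  cosine, its derivative.\<close>

lemma
  assumes "gen_surface S"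
  shows continuous_lin: "continuous_on (pdom S) (lin a b S)"
    and continuous_dlin: "continuous_on (pdom S) (dlin a b S)"
    and lin_has_derivative: "t \<in> pdom S \<Longrightarrow>
      (lin a b S has_real_derivative dlin a b S t * cos (ang S t)) (at t within pdom S)"
proof -
  note S = gen_surfaceD[OF assms] gen_surface_continuous[OF assms]
  show "continuous_on (pdom S) (lin a b S)" unfolding lin_def
    by (intro continuous_intros S)
  show "continuous_on (pdom S) (dlin a b S)" unfolding dlin_def
    by (intro continuous_intros S)
  show "(lin a b S has_real_derivative dlin a b S t * cos (ang S t)) (at t within pdom S)"
    if t: "t \<in> pdom S"
    unfolding lin_def [abs_def] dlin_def
    by (rule derivative_eq_intros S(5)[OF t] S(7)[OF t] refl)+ (simp add: algebra_simps)
qed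

text \<open>The angle is strictly monotone, so its cosine vanishes only at isolated points.\<close>

lemma cos_ang_factor_zero:
  assumes S: "gen_surface S" "\<And>t. t \<in> pdom S \<Longrightarrow> trn S t \<noteq> 0"
    and f: "continuous_on (pdom S) f"
    and 0: "\<And>t. t \<in> interior (pdom S) \<Longrightarrow> f t * cos (ang S t) = 0"
    and t: "t \<in> pdom S"
  shows "f t = 0"
proof -
  note D = gen_surfaceD[OF S(1)]
  obtain a b where ab: "a \<in> pdom S" "b \<in> pdom S" "a < b" using D(2) by blast
  have "f s = 0" if s: "s \<in> interior (pdom S)" for s
  proof (rule ccontr)
    assume "f s \<noteq> 0"
    have "isCont f s" using f s continuous_on_interior by blast
    then have "\<forall>\<^sub>F r in nhds s. f r \<noteq> 0"
      using \<open>f s \<noteq> 0\<close> by (auto simp: isCont_def tendsto_imp_eventually_ne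
          eventually_nhds_conv_at)
    moreover have "\<forall>\<^sub>F r in nhds s. r \<in> interior (pdom S)"
      using s by (simp add: eventually_nhds_in_open)
    \<comment> \<open>Vanishing on a neighbourhood, the cosine has derivative zero, so
      \<open>sin (ang S s) * trn S s = 0\<close>; but neither factor vanishes.\<close>
    ultimately have c: "\<forall>\<^sub>F r in nhds s. cos (ang S r) = 0"
      by eventually_elim (use 0 in fastforce)
    have "s \<in> pdom S" using s interior_subset by blast
    then have "(ang S has_real_derivative trn S s) (at s)"
      using D(7)[of s] s at_within_interior by metis
    then have "((\<lambda>r. cos (ang S r)) has_real_derivative - (sin (ang S s) * trn S s)) (at s)"
      by (auto intro!: derivative_eq_intros)
    moreover have "((\<lambda>r. cos (ang S r)) has_real_derivative 0) (at s)"
      using c by (subst DERIV_cong_ev[OF refl _ refl]) auto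
    ultimately have "sin (ang S s) * trn S s = 0" using DERIV_unique by fastforce
    moreover have "sin (ang S s) \<noteq> 0"
      using eventually_nhds_x_imp_x[OF c] sin_cos_squared_add[of "ang S s"]
      by (metis power_zero_numeral add_0 zero_neq_one)
    ultimately show False using S(2)[OF \<open>s \<in> pdom S\<close>] by simp
  qed
  then show ?thesis
    using eq_on_interior_imp_eq[OF D(1) ab f continuous_on_const[of _ 0]] t by blast
qed

text \<open>For a constant form \<open>dlin a b S t * cos (ang S t)\<close> would vanish, and the
  cosine cancels by continuity. This makes the parameter intervals of reciprocal preimages
  nondegenerate.\<close>

lemma lin_not_constant:
  assumes S: "gen_surface S" "\<And>t. t \<in> pdom S \<Longrightarrow> trn S t \<noteq> 0"
    and nz: "\<And>t. t \<in> pdom S \<Longrightarrow> dlin a b S t \<noteq> 0"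
  shows "\<exists>x \<in> lin a b S ` pdom S. \<exists>y \<in> lin a b S ` pdom S. x < y"
proof (rule ccontr)
  assume neg: "\<not> ?thesis"
  obtain t0 where t0: "t0 \<in> pdom S" using gen_surfaceD(2)[OF S(1)] by blast
  have const: "lin a b S t = lin a b S t0" if "t \<in> pdom S" for t
    using neg that t0 by (meson imageI linorder_less_linear)
  have "dlin a b S t * cos (ang S t) = 0" if t: "t \<in> interior (pdom S)" for t
  proof -
    have tp: "t \<in> pdom S" using t interior_subset by blast
    have "(lin a b S has_real_derivative dlin a b S t * cos (ang S t)) (at t)"
      using lin_has_derivative[OF S(1) tp] t at_within_interior by metis
    moreover have "\<forall>\<^sub>F r in nhds t. lin a b S r = lin a b S t0"
      using eventually_nhds_in_open[OF open_interior t]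
      by eventually_elim (use const interior_subset in blast)
    then have "(lin a b S has_real_derivative 0) (at t)"
      by (subst DERIV_cong_ev[OF refl _ refl]) auto
    ultimately show ?thesis using DERIV_unique by blast
  qed
  then have "dlin a b S t0 = 0"
    using cos_ang_factor_zero[OF S continuous_dlin[OF S(1)]] t0 by blast
  with nz t0 show False by blast
qed

section \<open>Parallel translations and preimages under reciprocal transformations\<close>

definition translate :: "real \<Rightarrow> profile \<Rightarrow> profile" where
  "translate v S = \<lparr>pdom = pdom S, rho = lin 1 v S, hgt = \<lambda>t. hgt S t + v * cos (ang S t),
     ang = ang S, spd = dlin 1 v S, trn = trn S\<rparr>"

lemma translate_simps [simp]:
  "pdom (translate v S) = pdom S" "rho (translate v S) t = rho S t + v * sin (ang S t)"
  "hgt (translate v S) t = hgt S t + v * cos (ang S t)" "ang (translate v S) = ang S"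
  "spd (translate v S) t = spd S t + v * trn S t" "trn (translate v S) = trn S"
  by (simp_all add: translate_def lin_def dlin_def)

lemma gen_surface_translate:
  assumes "gen_surface S"
  shows "gen_surface (translate v S)"
proof -
  note S = gen_surfaceD[OF assms]
  have "(hgt (translate v S) has_real_derivative - (dlin 1 v S t * sin (ang S t)))
      (at t within pdom S)" if t: "t \<in> pdom S" for t
    unfolding translate_def dlin_def profile.simps
    by (rule derivative_eq_intros S(6)[OF t] S(7)[OF t] refl)+ (simp add: algebra_simps)
  then show ?thesis
    unfolding gen_surface_def
    using S lin_has_derivative[OF assms, of _ 1 v] continuous_dlin[OF assms, of 1 v]
    by (auto simp: translate_def lin_def[of 1 v S "_ :: real"] dlin_def[of 1 v S "_ :: real"])
qed

lemma elementary_translate: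
  assumes "gen_surface S"
  shows "elementary (translate v S) S" "elementary S (translate v S)"
proof -
  have "parallel_translation v S (translate v S)" "parallel_translation (- v) (translate v S) S"
    by (auto simp: parallel_translation_def)
  then show "elementary (translate v S) S" "elementary S (translate v S)"
    using assms gen_surface_translate[OF assms] unfolding elementary_def by blast+
qed

text \<open>
  The image surface \<open>S2\<close> may fold back and forth over the curve \<open>(P, Q)\<close> traced out by its
  pair \<open>(rho, sin ang)\<close>, turning at the equators. The preimage is parametrised by that curve.
\<close>

lemma reciprocal_preimage:
  fixes S2 :: profile
  assumes S2: "gen_surface S2"
    and I: "is_interval I" "\<exists>a\<in>I. \<exists>b\<in>I. a < b"
    and \<phi>: "continuous_on (pdom S2) \<phi>" "\<phi> ` pdom S2 = I"
    and P: "\<And>x. x \<in> I \<Longrightarrow> (P has_real_derivative P' x) (at x within I)" "continuous_on I P'"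
    and Q: "\<And>x. x \<in> I \<Longrightarrow> (Q has_real_derivative Q' x) (at x within I)" "continuous_on I Q'"
    and reg: "\<And>x. x \<in> I \<Longrightarrow> (P' x, Q' x) \<noteq> (0, 0)"
    and int: "\<And>x. x \<in> interior I \<Longrightarrow> (P x, Q x) \<noteq> (0, 0)"
    and A: "\<And>x. x \<in> I \<Longrightarrow> \<bar>P x\<bar> < A"
    and lift: "\<And>t. t \<in> pdom S2 \<Longrightarrow> rho S2 t = P (\<phi> t)"
      "\<And>t. t \<in> pdom S2 \<Longrightarrow> sin (ang S2 t) = Q (\<phi> t)"
      "\<And>t. t \<in> pdom S2 \<Longrightarrow> spd S2 t * Q' (\<phi> t) = trn S2 t * P' (\<phi> t)"
  obtains S1 where "elementary S1 S2" "gen_surface S1" "pdom S1 = I"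
    "\<And>x. x \<in> I \<Longrightarrow> rho S1 x = Q x / A" "\<And>x. x \<in> I \<Longrightarrow> sin (ang S1 x) = - P x / A"
    "\<And>x. x \<in> I \<Longrightarrow> \<exists>c. c \<noteq> 0 \<and> spd S1 x = c * Q' x \<and> trn S1 x = - c * P' x"
proof -
  have A0: "0 < A" using A I(2) by fastforce
  have PA: "- 1 < - P x / A" "- P x / A < 1" if "x \<in> I" for x
    using A[OF that] A0 by (auto simp: field_simps abs_less_iff)
  \<comment> \<open>As \<open>A\<close> strictly exceeds \<open>\<bar>P x\<bar>\<close>, the
    principal branch stays inside the open interval where the cosine is positive and
    \<open>arcsin\<close> is differentiable.\<close>
  define an where "an x = arcsin (- P x / A)" for x
  have sin_an: "sin (an x) = - P x / A" if "x \<in> I" for x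
    using PA[OF that] by (simp add: an_def)
  have cos_an: "0 < cos (an x)" if "x \<in> I" for x
    using PA[OF that] arcsin_bounded[of "- P x / A"] arcsin_lt_bounded[of "- P x / A"]
    unfolding an_def by (intro cos_gt_zero_pi) auto
  have contP: "continuous_on I P"
    using P(1) by (auto simp: continuous_on_eq_continuous_within intro: DERIV_continuous)
  have cont_an: "continuous_on I an"
    unfolding an_def [abs_def] using PA A0
    by (intro continuous_intros contP) (auto intro: less_imp_le)
  \<comment> \<open>The factor forced by \<open>rho' = spd * cos ang\<close> for
    \<open>rho = Q / A\<close>; differentiating the arcsine produces the same one for
    \<open>trn\<close>.\<close>
  define c where "c x = 1 / (A * cos (an x))" for x
  have c0: "c x \<noteq> 0" if "x \<in> I" for x using cos_an[OF that] A0 by (simp add: c_def)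
  have contc: "continuous_on I c"
    unfolding c_def [abs_def] using cos_an A0
    by (intro continuous_intros cont_an) force
  have "continuous_on I (\<lambda>x. - (c x * Q' x * sin (an x)))"
    by (intro continuous_intros contc cont_an Q)
  then obtain H where H: "\<And>x. x \<in> I \<Longrightarrow>
      (H has_real_derivative - (c x * Q' x * sin (an x))) (at x within I)"
    using continuous_primitive_interval[OF I(1)] by blast
  define S1 where "S1 = \<lparr>pdom = I, rho = \<lambda>x. Q x / A, hgt = H, ang = an,
     spd = \<lambda>x. c x * Q' x, trn = \<lambda>x. - c x * P' x\<rparr>"
  have d_rho: "((\<lambda>x. Q x / A) has_real_derivative c x * Q' x * cos (an x)) (at x within I)"
    if x: "x \<in> I" for x
    by (rule derivative_eq_intros Q(1)[OF x] refl)+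
      (use A0 cos_an[OF x] in \<open>auto simp: c_def field_simps\<close>)
  have d_ang: "(an has_real_derivative - c x * P' x) (at x within I)" if x: "x \<in> I" for x
  proof -
    have "((\<lambda>x. - P x / A) has_real_derivative - P' x / A) (at x within I)"
      by (rule derivative_eq_intros P(1)[OF x] refl)+ (use A0 in auto)
    from DERIV_chain2[OF DERIV_arcsin this] PA[OF x]
    have "(an has_real_derivative inverse (sqrt (1 - (- P x / A)\<^sup>2)) * (- P' x / A))
        (at x within I)"
      unfolding an_def [abs_def] by blast
    moreover have "sqrt (1 - (- P x / A)\<^sup>2) = cos (an x)"
      unfolding an_def using PA[OF x] by (simp add: cos_arcsin)
    ultimately show ?thesis by (simp add: c_def field_simps)
  qed
  have gen: "gen_surface S1"
    unfolding gen_surface_def S1_def profile.simps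
  proof (intro conjI ballI I)
    show "continuous_on I (\<lambda>x. c x * Q' x)" "continuous_on I (\<lambda>x. - c x * P' x)"
      by (intro continuous_intros contc P Q)+
    show "(c x * Q' x, - c x * P' x) \<noteq> (0, 0)" if "x \<in> I" for x
      using reg[OF that] c0[OF that] by auto
    show "(Q x / A, sin (an x)) \<noteq> (0, 0)" if "x \<in> interior I" for x
      using int[OF that] sin_an[of x] A0 that interior_subset[of I] by auto
  qed (use d_rho d_ang H in auto)
  have "reciprocal A S1 S2"
    unfolding reciprocal_def
  proof (intro exI[of _ \<phi>] conjI ballI)
    fix t assume t: "t \<in> pdom S2"
    then have x: "\<phi> t \<in> I" using \<phi> by blast
    show "sin (ang S2 t) = A * rho S1 (\<phi> t)"
      using lift(2)[OF t] A0 by (simp add: S1_def)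
    show "rho S2 t = - A * sin (ang S1 (\<phi> t))"
      using lift(1)[OF t] A0 sin_an[OF x] by (simp add: S1_def)
    have r2: "fst (radius2 S2 t) * fst (radius2 S1 (\<phi> t))
        = - (snd (radius2 S2 t) * snd (radius2 S1 (\<phi> t)))"
      \<comment> \<open>By \<open>lift(3)\<close> the vector \<open>(spd S2 t, trn S2 t)\<close> is
        parallel to \<open>(P', Q')\<close>, while that of \<open>S1\<close> is a multiple of the
        quarter turn \<open>(Q', - P')\<close>.\<close>
      using lift(3)[OF t] by (simp add: radius2_def S1_def)
    moreover have "fst (radius1 S2 t) * fst (radius1 S1 (\<phi> t))
        = - (snd (radius1 S2 t) * snd (radius1 S1 (\<phi> t)))"
    proof (cases "P (\<phi> t) = 0 \<and> Q (\<phi> t) = 0")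
      case True
      then have "radius1 S2 t = radius2 S2 t" "radius1 S1 (\<phi> t) = radius2 S1 (\<phi> t)"
        using lift[OF t] sin_an[OF x] by (auto simp: radius1_def S1_def)
      with r2 show ?thesis by simp
    next
      case False
      then have "radius1 S2 t = (P (\<phi> t), Q (\<phi> t))"
        "radius1 S1 (\<phi> t) = (Q (\<phi> t) / A, - P (\<phi> t) / A)"
        using lift[OF t] sin_an[OF x] A0 by (auto simp: radius1_def S1_def)
      then show ?thesis by simp
    qed
    ultimately show "fst (r S2 t) * fst (r S1 (\<phi> t)) = - (snd (r S2 t) * snd (r S1 (\<phi> t)))"
      if "r \<in> {radius1, radius2}" for r using that by blast
  qed (use \<phi> in \<open>auto simp: S1_def\<close>)
  then have "\<exists>A. A \<noteq> 0 \<and> reciprocal A S1 S2"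
    using A0 by (intro exI[of _ A]) simp
  then have "elementary S1 S2" by (simp add: elementary_def S2 gen)
  then show ?thesis
  proof (rule that)
    show "\<exists>c. c \<noteq> 0 \<and> spd S1 x = c * Q' x \<and> trn S1 x = - c * P' x" if "x \<in> I" for x
      using c0[OF that] by (auto simp: S1_def)
  qed (use gen sin_an in \<open>auto simp: S1_def\<close>)
qed

text \<open>Away from the axis \<open>rel\<close> is the relation cleared of denominators. At a pole
  both curvatures are \<open>trn / spd\<close>, and \<open>trn = 0\<close> makes the relation hold
  there for every \<open>lam\<close>.\<close>

lemma weingarten_surfaceI:
  assumes "gen_surface T"
    and spd: "\<And>t. t \<in> pdom T \<Longrightarrow> spd T t \<noteq> 0"
    and pole: "\<And>t. t \<in> pdom T \<Longrightarrow> rho T t = 0 \<Longrightarrow> sin (ang T t) = 0 \<and> trn T t = 0"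
    and rel: "\<And>t. t \<in> pdom T \<Longrightarrow> trn T t * rho T t = lam * spd T t * sin (ang T t)"
  shows "surface_of_revolution T" "\<forall>t\<in>pdom T. curv2 T t = lam * curv1 T t"
proof -
  show "surface_of_revolution T"
    using assms by (auto simp: surface_of_revolution_def radius1_def radius2_def)
  show "\<forall>t\<in>pdom T. curv2 T t = lam * curv1 T t"
  proof
    fix t assume t: "t \<in> pdom T"
    show "curv2 T t = lam * curv1 T t"
    proof (cases "rho T t = 0")
      case True
      then show ?thesis using pole[OF t] by (simp add: curv1_def curv2_def radius1_def radius2_def)
    next
      case False
      then show ?thesis using rel[OF t] spd[OF t]
        by (simp add: curv1_def curv2_def radius1_def radius2_def field_simps)
    qed
  qed
qed

lemma non_flatD:
  assumes "surface_of_revolution S" "non_flat S" "t \<in> pdom S"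
  shows "spd S t \<noteq> 0" "trn S t \<noteq> 0" "rho S t = 0 \<longleftrightarrow> sin (ang S t) = 0"
  using assms
  by (auto simp: surface_of_revolution_def non_flat_def curv1_def curv2_def radius1_def
      radius2_def split: if_splits)

text \<open>On a non-flat surface the zeros of \<open>sin (ang S t)\<close> are exactly the poles,
  and these are end points of the domain; deleting end points leaves an interval.\<close>

lemma nonpole_interval:
  assumes S: "surface_of_revolution S" "non_flat S"
  defines "J \<equiv> {t \<in> pdom S. sin (ang S t) \<noteq> 0}"
  shows "is_interval J" "interior (pdom S) \<subseteq> J"
proof -
  have gen: "gen_surface S" using S by (simp add: surface_of_revolution_def)
  show int: "interior (pdom S) \<subseteq> J"
  proof
    fix t assume t: "t \<in> interior (pdom S)"
    then have "t \<in> pdom S" using interior_subset by blast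
    then show "t \<in> J" using gen_surfaceD(9)[OF gen t] non_flatD(3)[OF S] by (auto simp: J_def)
  qed
  have "b \<in> J" if "a \<in> J" "c \<in> J" "a \<le> b" "b \<le> c" for a b c
  proof (cases "b = a \<or> b = c")
    case False
    have "{a<..<c} \<subseteq> pdom S"
      using mem_is_interval_1_I[OF gen_surfaceD(1)[OF gen], of a c] that by (auto simp: J_def)
    then have "{a<..<c} \<subseteq> interior (pdom S)" by (intro interior_maximal) auto
    moreover have "b \<in> {a<..<c}" using False that by auto
    ultimately show ?thesis using int by blast
  qed (use that in auto)
  then show "is_interval J" unfolding is_interval_1 by blast
qed

lemma elementary_imp_image:
  assumes "elementary T S1" "elementary S1 S2" "elementary S2 S"
  shows "image_under_composition T S"
  using assms unfolding image_under_composition_def by (meson r_into_rtranclp rtranclp_trans)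

text \<open>
  If \<open>r\<^sub>2\<close> is constant, a parallel translation shrinks the profile circle to its centre. This is the
  reciprocal image of a plane if the centre lies on the axis, and of a cone otherwise.
\<close>

lemma constant_radius2_image:
  assumes S: "surface_of_revolution S" "non_flat S"
    and U: "\<And>t. t \<in> pdom S \<Longrightarrow> dlin 1 v S t = 0"
    and lam: "lam = 0 \<or> (\<forall>t\<in>pdom S. lin 1 v S t = 0)"
  shows "\<exists>T. surface_of_revolution T \<and> (\<forall>t\<in>pdom T. curv2 T t = lam * curv1 T t) \<and>
    image_under_composition T S"
proof -
  have gen: "gen_surface S" using S by (simp add: surface_of_revolution_def)
  note trn = non_flatD(2)[OF S]
  have "(lin 1 v S has_real_derivative 0) (at t within pdom S)" if "t \<in> pdom S" for t
    using lin_has_derivative[OF gen that, of 1 v] U[OF that] by simp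
  then obtain c where c: "\<And>t. t \<in> pdom S \<Longrightarrow> lin 1 v S t = c"
    using has_field_derivative_zero_constant[OF is_interval_convex[OF gen_surfaceD(1)[OF gen]],
        of "lin 1 v S"] by blast
  \<comment> \<open>\<open>c\<close> is the signed distance of the centre from the axis. A cone,
    \<open>c \<noteq> 0\<close>, needs \<open>lam = 0\<close>; a plane, \<open>c = 0\<close>,
    satisfies the relation for every \<open>lam\<close>.\<close>
  have lamc: "lam = 0 \<or> c = 0" using lam c gen_surfaceD(2)[OF gen] by fastforce
  define S2 where "S2 = translate v S"
  have S2: "gen_surface S2" "pdom S2 = pdom S"
    using gen by (simp_all add: S2_def gen_surface_translate)
  define \<phi> where "\<phi> = lin 0 1 S"
  define I where "I = \<phi> ` pdom S"
  have \<phi>: "continuous_on (pdom S) \<phi>" unfolding \<phi>_def by (rule continuous_lin[OF gen])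
  have I: "is_interval I"
    using \<phi> gen_surfaceD(1)[OF gen]
    by (simp add: I_def is_interval_connected_1 connected_continuous_image)
  have I_nontriv: "\<exists>a\<in>I. \<exists>b\<in>I. a < b"
    unfolding I_def \<phi>_def using trn by (intro lin_not_constant[OF gen]) (auto simp: dlin_def)
  \<comment> \<open>The sine keeps its sign off the poles, so zero can only be an end point of its
    range. Hence the vertical line \<open>(c, x)\<close> misses the origin at interior parameters
    even if \<open>c = 0\<close>.\<close>
  have int0: "0 \<notin> interior I"
  proof -
    define J where "J = {t \<in> pdom S. sin (ang S t) \<noteq> 0}"
    have "continuous_on J \<phi>" by (rule continuous_on_subset[OF \<phi>]) (auto simp: J_def)
    then have "(\<forall>t\<in>J. 0 < \<phi> t) \<or> (\<forall>t\<in>J. \<phi> t < 0)"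
      using nonpole_interval(1)[OF S]
      by (intro continuous_nonzero_sign) (auto simp: J_def \<phi>_def lin_def)
    then have "I \<subseteq> {0..} \<or> I \<subseteq> {..0}"
      unfolding I_def J_def \<phi>_def lin_def by force
    then have "interior I \<subseteq> {0<..} \<or> interior I \<subseteq> {..<0}"
      by (metis interior_mono interior_real_atLeast interior_real_atMost)
    then show ?thesis by auto
  qed
  define A where "A = \<bar>c\<bar> + 1"
  have A0: "0 < A" by (simp add: A_def)
  obtain S1 where S1: "elementary S1 S2" "gen_surface S1" "pdom S1 = I"
    "\<And>x. x \<in> I \<Longrightarrow> rho S1 x = x / A" "\<And>x. x \<in> I \<Longrightarrow> sin (ang S1 x) = - c / A"
    "\<And>x. x \<in> I \<Longrightarrow> \<exists>c. c \<noteq> 0 \<and> spd S1 x = c * 1 \<and> trn S1 x = - c * 0"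
  proof (rule reciprocal_preimage[OF S2(1) I I_nontriv, where \<phi> = \<phi> and P = "\<lambda>_. c"
        and Q = "\<lambda>x. x" and P' = "\<lambda>_. 0" and Q' = "\<lambda>_. 1" and A = A])
    show "(c, x) \<noteq> (0, 0)" if "x \<in> interior I" for x using that int0 by auto
  qed (use \<phi> c U in \<open>auto simp: S2 I_def A_def S2_def \<phi>_def lin_def dlin_def\<close>)
  \<comment> \<open>For \<open>c \<noteq> 0\<close> this adds \<open>2 / A\<close> to
    \<open>rho\<close>, pushing the cone off the axis since \<open>\<bar>x\<bar> \<le> 1\<close>.
    For \<open>c = 0\<close> the convention \<open>- 2 / 0 = 0\<close> leaves the plane in
    place.\<close>
  define T where "T = translate (- 2 / c) S1"
  have T: "gen_surface T" "pdom T = I" using S1 by (simp_all add: T_def gen_surface_translate)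
  have T_data: "spd T x \<noteq> 0" "trn T x = 0" "sin (ang T x) = - c / A"
    "rho T x = (if c = 0 then x / A else (x + 2) / A)" if "x \<in> I" for x
    using S1(6)[OF that] A0
    by (auto simp: T_def S1(4,5)[OF that] add_divide_distrib)
  have pole: "sin (ang T x) = 0 \<and> trn T x = 0" if x: "x \<in> I" "rho T x = 0" for x
  proof -
    have "\<bar>x\<bar> \<le> 1" using x(1) by (auto simp: I_def \<phi>_def lin_def)
    with x A0 T_data[OF x(1)] show ?thesis by (auto split: if_splits)
  qed
  have "surface_of_revolution T" "\<forall>t\<in>pdom T. curv2 T t = lam * curv1 T t"
    using T_data pole lamc by (intro weingarten_surfaceI; auto simp: T)+
  moreover have "image_under_composition T S"
    using elementary_imp_image[OF _ S1(1)] elementary_translate(1)[OF S1(2)]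
      elementary_translate(1)[OF gen] by (simp add: T_def S2_def)
  ultimately show ?thesis by blast
qed

section \<open>The curve traced out by \<open>(rho, sin ang)\<close>\<close>

lemma linear_forms_zero:
  fixes p q m n x y :: real
  assumes "p * n - q * m \<noteq> 0" "p * x + q * y = 0" "m * x + n * y = 0"
  shows "x = 0" "y = 0"
proof -
  have "(p * n - q * m) * x = n * (p * x + q * y) - q * (m * x + n * y)"
    "(p * n - q * m) * y = p * (m * x + n * y) - m * (p * x + q * y)" by algebra+
  with assms show "x = 0" "y = 0" by auto
qed

text \<open>
  In the isotropic coordinates \<open>(u, w)\<close> of the Weingarten relation the curve is an integral curve of
  the linear vector field \<open>(- \<kappa>2 u, \<kappa>1 w)\<close>. The first two alternatives are spheres.
\<close>

lemma isotropic_coordinates: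
  assumes S: "surface_of_revolution S" "non_flat S"
    and det: "p * n - q * m \<noteq> 0"
    and \<kappa>: "\<kappa>1 \<noteq> 0" "\<kappa>2 \<noteq> 0"
    and lam: "lam = - \<kappa>2 / \<kappa>1" "lam < 0 \<or> 1 < lam"
    and rel: "\<And>t. t \<in> pdom S \<Longrightarrow>
      \<kappa>1 * lin m n S t * dlin p q S t + \<kappa>2 * lin p q S t * dlin m n S t = 0"
  shows "(\<forall>t\<in>pdom S. dlin p q S t = 0 \<and> lin p q S t = 0) \<or>
    (\<forall>t\<in>pdom S. dlin m n S t = 0 \<and> lin m n S t = 0) \<or>
    (\<exists>C \<sigma>. C \<noteq> 0 \<and> \<sigma>\<^sup>2 = 1 \<and> (\<forall>t\<in>pdom S.
       0 \<le> \<sigma> * lin m n S t \<and> (\<sigma> * lin m n S t = 0 \<longrightarrow> 1 < lam) \<and> dlin m n S t \<noteq> 0 \<and>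
       lin p q S t = C * (\<sigma> * lin m n S t) powr lam \<and>
       dlin p q S t = \<sigma> * lam * C * (\<sigma> * lin m n S t) powr (lam - 1) * dlin m n S t))"
proof -
  have gen: "gen_surface S" using S by (simp add: surface_of_revolution_def)
  define J where "J = {t \<in> pdom S. sin (ang S t) \<noteq> 0}"
  have J: "is_interval J" "interior (pdom S) \<subseteq> J" "J \<subseteq> pdom S"
    using nonpole_interval[OF S] by (auto simp: J_def)
  define u w U W where "u = lin p q S" and "w = lin m n S" and "U = dlin p q S" and "W = dlin m n S"
  have cont: "continuous_on (pdom S) u" "continuous_on (pdom S) w"
    "continuous_on (pdom S) U" "continuous_on (pdom S) W"
    unfolding u_def w_def U_def W_def using continuous_lin[OF gen] continuous_dlin[OF gen] by auto
  have R: "\<kappa>1 * w t * U t + \<kappa>2 * u t * W t = 0" if "t \<in> pdom S" for t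
    using rel[OF that] by (simp add: u_def w_def U_def W_def)
  have UW: "U t \<noteq> 0 \<or> W t \<noteq> 0" if "t \<in> pdom S" for t
    using linear_forms_zero[OF det, of "spd S t" "trn S t"] non_flatD(1)[OF S that]
    by (auto simp: U_def W_def dlin_def)
  have uw: "u t \<noteq> 0 \<or> w t \<noteq> 0" if "t \<in> J" for t
    using linear_forms_zero[OF det, of "rho S t" "sin (ang S t)"] that
    by (auto simp: u_def w_def lin_def J_def)
  have pole: "u t = 0 \<and> w t = 0" if "t \<in> pdom S" "t \<notin> J" for t
    using that non_flatD(3)[OF S that(1)] by (auto simp: u_def w_def lin_def J_def)
  obtain a b where ab: "a \<in> pdom S" "b \<in> pdom S" "a < b" using gen_surfaceD(2)[OF gen] by blast
  have extend: "f t = g t" if "continuous_on (pdom S) f" "continuous_on (pdom S) g"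
    "\<And>t. t \<in> J \<Longrightarrow> f t = g t" "t \<in> pdom S" for f g :: "real \<Rightarrow> real" and t
    using eq_on_interior_imp_eq[OF gen_surfaceD(1)[OF gen] ab that(1,2) _ that(4)] that(3) J(2)
    by blast
  define N where "N t = (\<kappa>1 * w t)\<^sup>2 + (\<kappa>2 * u t)\<^sup>2" for t
  have N: "N t \<noteq> 0" if "t \<in> J" for t
    using uw[OF that] \<kappa> by (auto simp: N_def sum_power2_eq_zero_iff)
  \<comment> \<open>The relation makes \<open>(U, W)\<close> parallel to
    \<open>(- \<kappa>2 u, \<kappa>1 w)\<close>; the factor is the inner product divided by the
    squared norm, hence continuous off the poles.\<close>
  define \<mu> where "\<mu> t = (\<kappa>1 * w t * W t - \<kappa>2 * u t * U t) / N t" for t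
  have U: "U t = - \<kappa>2 * \<mu> t * u t" and W: "W t = \<kappa>1 * \<mu> t * w t" if "t \<in> J" for t
  proof -
    have r: "\<kappa>1 * w t * U t + \<kappa>2 * u t * W t = 0" using R that J(3) by blast
    have "U t * N t = - \<kappa>2 * (\<kappa>1 * w t * W t - \<kappa>2 * u t * U t) * u t"
      "W t * N t = \<kappa>1 * (\<kappa>1 * w t * W t - \<kappa>2 * u t * U t) * w t"
      unfolding N_def using r by algebra+
    with N[OF that] show "U t = - \<kappa>2 * \<mu> t * u t" "W t = \<kappa>1 * \<mu> t * w t"
      by (simp_all add: \<mu>_def field_simps)
  qed
  note contJ = cont[THEN continuous_on_subset, OF J(3)]
  have "continuous_on J (\<lambda>t. \<mu> t * cos (ang S t))"
    unfolding \<mu>_def N_def using N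
    by (intro continuous_intros contJ J(3)
        continuous_on_subset[OF gen_surface_continuous(2)[OF gen]]) (auto simp: N_def)
  then obtain F where F: "\<And>t. t \<in> J \<Longrightarrow>
      (F has_real_derivative \<mu> t * cos (ang S t)) (at t within J)"
    using continuous_primitive_interval[OF J(1)] by blast
  have du: "(u has_real_derivative - \<kappa>2 * (\<mu> t * cos (ang S t)) * u t) (at t within J)"
    and dw: "(w has_real_derivative \<kappa>1 * (\<mu> t * cos (ang S t)) * w t) (at t within J)"
    if t: "t \<in> J" for t
  proof -
    have tp: "t \<in> pdom S" using t J by blast
    show "(u has_real_derivative - \<kappa>2 * (\<mu> t * cos (ang S t)) * u t) (at t within J)"
      using has_field_derivative_subset[OF lin_has_derivative[OF gen tp, of p q] J(3)] U[OF t]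
      by (simp add: u_def U_def mult_ac)
    show "(w has_real_derivative \<kappa>1 * (\<mu> t * cos (ang S t)) * w t) (at t within J)"
      using has_field_derivative_subset[OF lin_has_derivative[OF gen tp, of m n] J(3)] W[OF t]
      by (simp add: w_def W_def mult_ac)
  qed
  obtain u0 where u0: "\<And>t. t \<in> J \<Longrightarrow> u t = u0 * exp (- \<kappa>2 * F t)"
    using linear_ode_solution[OF J(1) F du] by blast
  obtain w0 where w0: "\<And>t. t \<in> J \<Longrightarrow> w t = w0 * exp (\<kappa>1 * F t)"
    using linear_ode_solution[OF J(1) F dw] by blast
  consider "u0 = 0" | "w0 = 0" | "u0 \<noteq> 0" "w0 \<noteq> 0" by blast
  then show ?thesis
  proof cases
    case 1
    have "u t = 0" "U t = 0" if "t \<in> pdom S" for t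
      using extend[OF cont(1) continuous_on_const[of _ 0] _ that]
        extend[OF cont(3) continuous_on_const[of _ 0] _ that] u0 U 1 by auto
    then show ?thesis by (simp add: u_def U_def)
  next
    case 2
    have "w t = 0" "W t = 0" if "t \<in> pdom S" for t
      using extend[OF cont(2) continuous_on_const[of _ 0] _ that]
        extend[OF cont(4) continuous_on_const[of _ 0] _ that] w0 W 2 by auto
    then show ?thesis by (simp add: w_def W_def)
  next
    case 3
    define \<sigma> where "\<sigma> = sgn w0"
    have \<sigma>: "\<sigma>\<^sup>2 = 1" "\<sigma> * \<sigma> = 1" "\<sigma> * w0 = \<bar>w0\<bar>"
      using 3 by (auto simp: \<sigma>_def sgn_if)
    define X where "X t = \<sigma> * w t" for t
    have contX: "continuous_on (pdom S) X" unfolding X_def by (intro continuous_intros cont)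
    \<comment> \<open>Both \<open>u\<close> and \<open>w\<close> are exponentials of multiples of
      one \<open>F\<close>; as \<open>\<kappa>1 * lam = - \<kappa>2\<close>, eliminating
      \<open>F\<close> leaves this constant.\<close>
    define C where "C = u0 / \<bar>w0\<bar> powr lam"
    have C: "C \<noteq> 0" using 3 by (simp add: C_def)
    have X: "X t = \<bar>w0\<bar> * exp (\<kappa>1 * F t)" if "t \<in> J" for t
      using w0[OF that] \<sigma>(3) by (simp add: X_def flip: mult.assoc)
    have X_pos: "0 < X t" if "t \<in> J" for t using X[OF that] 3 by simp
    have X_pole: "X t = 0" if "t \<in> pdom S" "t \<notin> J" for t using pole[OF that] by (simp add: X_def)
    have X_nn: "0 \<le> X t" if "t \<in> pdom S" for t using X_pos X_pole that by force
    have uJ: "u t = C * X t powr lam" if "t \<in> J" for t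
    proof -
      have "\<kappa>1 * lam = - \<kappa>2" using lam \<kappa> by simp
      then have "X t powr lam = \<bar>w0\<bar> powr lam * exp (- \<kappa>2 * F t)"
        using X[OF that] by (simp add: powr_mult exp_powr_real mult.commute mult.left_commute
            flip: mult.assoc)
      then show ?thesis using u0[OF that] 3 by (simp add: C_def)
    qed
    \<comment> \<open>For negative \<open>lam\<close> the continuous product
      \<open>u t * X t powr (- lam)\<close> equals \<open>C \<noteq> 0\<close> off the poles but
      vanishes at a pole.\<close>
    have no_pole: "1 < lam" if t: "t \<in> pdom S" "t \<notin> J" for t
    proof (rule ccontr)
      assume "\<not> 1 < lam"
      then have neg: "lam < 0" using lam by simp
      have "continuous_on (pdom S) (\<lambda>t. u t * X t powr (- lam))"
        using neg X_nn by (intro continuous_intros cont continuous_on_powr' contX) auto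
      moreover have "u t * X t powr (- lam) = C" if "t \<in> J" for t
        using uJ[OF that] X_pos[OF that] by (simp add: powr_minus)
      ultimately have "u t * X t powr (- lam) = C"
        using extend[OF _ continuous_on_const[of _ C] _ t(1)] by blast
      with C pole[OF t] show False by simp
    qed
    have u: "u t = C * X t powr lam" if "t \<in> pdom S" for t
      using uJ pole X_pole that by (cases "t \<in> J") auto
    have UJ: "U t = \<sigma> * lam * C * X t powr (lam - 1) * W t" if t: "t \<in> J" for t
    proof -
      have "X t * U t = \<sigma> * (lam * u t * W t)"
      proof -
        have "\<kappa>1 * w t * U t + \<kappa>2 * u t * W t = 0" using R t J(3) by blast
        moreover have "\<kappa>2 = - (\<kappa>1 * lam)" using lam \<kappa> by simp
        ultimately have "\<kappa>1 * (w t * U t - lam * u t * W t) = 0" by algebra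
        with \<kappa> have "w t * U t = lam * u t * W t" by simp
        then show ?thesis by (simp add: X_def mult.assoc)
      qed
      also have "u t = C * (X t powr (lam - 1) * X t)"
        using uJ[OF t] X_pos[OF t] by (simp add: powr_diff)
      finally show ?thesis using X_pos[OF t] by simp
    qed
    have UU: "U t = \<sigma> * lam * C * X t powr (lam - 1) * W t" if t: "t \<in> pdom S" for t
    proof (cases "t \<in> J")
      case False
      then have "1 < lam" using no_pole t by blast
      then have "continuous_on (pdom S) (\<lambda>t. \<sigma> * lam * C * X t powr (lam - 1) * W t)"
        using X_nn by (intro continuous_intros cont continuous_on_powr' contX) auto
      then show ?thesis using extend[OF cont(3) _ UJ t] by blast
    qed (rule UJ)
    \<comment> \<open>\<open>W t = 0\<close> would give \<open>U t = 0\<close> by the formula, but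
      the two never vanish together.\<close>
    have "0 \<le> X t \<and> (X t = 0 \<longrightarrow> 1 < lam) \<and> W t \<noteq> 0 \<and> u t = C * X t powr lam \<and>
        U t = \<sigma> * lam * C * X t powr (lam - 1) * W t" if "t \<in> pdom S" for t
      using X_nn[OF that] X_pos[of t] no_pole[OF that] UW[OF that] u[OF that] UU[OF that]
      by (cases "t \<in> J") auto
    then show ?thesis
      using C \<sigma>(1) unfolding X_def u_def w_def U_def W_def by blast
  qed
qed

lemma nonparabolic_image:
  assumes S: "surface_of_revolution S" "non_flat S"
    and det: "p * n - q * m \<noteq> 0"
    and \<kappa>: "\<kappa>1 \<noteq> 0" "\<kappa>2 \<noteq> 0"
    and lam: "lam = - \<kappa>2 / \<kappa>1" "lam < 0 \<and> (p = 0 \<or> m \<noteq> 0) \<or> 1 < lam"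
    and rel: "\<And>t. t \<in> pdom S \<Longrightarrow>
      \<kappa>1 * lin m n S t * dlin p q S t + \<kappa>2 * lin p q S t * dlin m n S t = 0"
  shows "\<exists>T. surface_of_revolution T \<and> (\<forall>t\<in>pdom T. curv2 T t = lam * curv1 T t) \<and>
    image_under_composition T S"
proof -
  have gen: "gen_surface S" using S by (simp add: surface_of_revolution_def)
  note trn = non_flatD(2)[OF S]
  \<comment> \<open>These are spheres centred on the axis; they come from a plane, where
    \<open>lam\<close> is arbitrary.\<close>
  have sphere: ?thesis
    if zero: "\<forall>t\<in>pdom S. dlin a b S t = 0 \<and> lin a b S t = 0" and ab: "a \<noteq> 0 \<or> b \<noteq> 0" for a b
  proof -
    obtain t0 where t0: "t0 \<in> pdom S" using gen_surfaceD(2)[OF gen] by blast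
    have "a \<noteq> 0" using zero t0 ab trn[OF t0] by (auto simp: dlin_def)
    then have "dlin 1 (b / a) S t = 0" "lin 1 (b / a) S t = 0" if "t \<in> pdom S" for t
      using zero that by (auto simp: dlin_def lin_def field_simps)
    then show ?thesis using constant_radius2_image[OF S, of "b / a" lam] by blast
  qed
  have lam': "lam < 0 \<or> 1 < lam" using lam by blast
  consider "\<forall>t\<in>pdom S. dlin p q S t = 0 \<and> lin p q S t = 0"
    | "\<forall>t\<in>pdom S. dlin m n S t = 0 \<and> lin m n S t = 0"
    | C \<sigma> where "C \<noteq> 0" "\<sigma>\<^sup>2 = 1" "\<forall>t\<in>pdom S.
       0 \<le> \<sigma> * lin m n S t \<and> (\<sigma> * lin m n S t = 0 \<longrightarrow> 1 < lam) \<and> dlin m n S t \<noteq> 0 \<and>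
       lin p q S t = C * (\<sigma> * lin m n S t) powr lam \<and>
       dlin p q S t = \<sigma> * lam * C * (\<sigma> * lin m n S t) powr (lam - 1) * dlin m n S t"
    using isotropic_coordinates[OF S det \<kappa> lam(1) lam' rel] by blast
  then show ?thesis
  proof cases
    case 1
    then show ?thesis using det by (intro sphere[of p q]) auto
  next
    case 2
    then show ?thesis using det by (intro sphere[of m n]) auto
  next
    case (3 C \<sigma>)
    define X where "X = lin (\<sigma> * m) (\<sigma> * n) S"
    have X_eq: "X t = \<sigma> * lin m n S t" for t by (simp add: X_def lin_def algebra_simps)
    have \<sigma>: "\<sigma> \<noteq> 0" "\<sigma> * \<sigma> = 1" using 3(2) by (auto simp: power2_eq_square)
    have X: "0 \<le> X t" "X t = 0 \<Longrightarrow> 1 < lam" "dlin m n S t \<noteq> 0"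
      "lin p q S t = C * X t powr lam"
      "dlin p q S t = \<sigma> * lam * C * X t powr (lam - 1) * dlin m n S t"
      if "t \<in> pdom S" for t
      using 3(3) that by (auto simp: X_eq)
    show ?thesis
    proof (cases "p = 0")
      case True
      then have "m \<noteq> 0" "q \<noteq> 0" using det by auto
      define T where "T = translate (n / m) S"
      have T: "gen_surface T" "pdom T = pdom S" using gen
        by (simp_all add: T_def gen_surface_translate)
      have T_data: "rho T t = lin m n S t / m" "spd T t = dlin m n S t / m"
        "sin (ang T t) = lin p q S t / q" "trn T t = dlin p q S t / q" for t
        using \<open>m \<noteq> 0\<close> \<open>q \<noteq> 0\<close> True by (simp_all add: T_def lin_def dlin_def field_simps)
      have rel': "dlin p q S t * lin m n S t = lam * dlin m n S t * lin p q S t"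
        if "t \<in> pdom S" for t
      proof -
        have "\<kappa>2 = - (\<kappa>1 * lam)" using lam \<kappa> by simp
        with rel[OF that] have "\<kappa>1 * (dlin p q S t * lin m n S t
            - lam * dlin m n S t * lin p q S t) = 0" by algebra
        with \<kappa> show ?thesis by simp
      qed
      have "surface_of_revolution T" "\<forall>t\<in>pdom T. curv2 T t = lam * curv1 T t"
      proof -
        have spd: "spd T t \<noteq> 0" if "t \<in> pdom T" for t
          using X(3) that \<open>m \<noteq> 0\<close> by (simp add: T_data T)
        have pole: "sin (ang T t) = 0 \<and> trn T t = 0" if t: "t \<in> pdom T" "rho T t = 0" for t
        proof -
          have "X t = 0" using t \<open>m \<noteq> 0\<close> by (simp add: T_data X_eq)
          then show ?thesis using X(4,5)[of t] t T by (simp add: T_data)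
        qed
        have weing: "trn T t * rho T t = lam * spd T t * sin (ang T t)" if "t \<in> pdom T" for t
          using rel'[of t] that T by (simp add: T_data mult.commute)
        show "surface_of_revolution T" "\<forall>t\<in>pdom T. curv2 T t = lam * curv1 T t"
          using weingarten_surfaceI[OF T(1) spd pole weing] by blast+
      qed
      moreover have "image_under_composition T S"
        using elementary_translate(1)[OF gen] by (auto simp: T_def image_under_composition_def)
      ultimately show ?thesis by blast
    next
      case False
      define D where "D = p * n - q * m"
      have D: "D \<noteq> 0" using det by (simp add: D_def)
      define S2 where "S2 = translate (q / p) S"
      have S2: "gen_surface S2" "pdom S2 = pdom S"
        using gen by (simp_all add: S2_def gen_surface_translate)
      \<comment> \<open>Solved for the sine, this gives \<open>Q\<close> below. Since
        \<open>\<bar>sin (ang S t)\<bar> \<le> 1\<close>, it also keeps \<open>p * w\<close> and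
        \<open>m * u\<close> within \<open>\<bar>D\<bar>\<close> of each other.\<close>
      have w_eq: "p * lin m n S t = m * lin p q S t + D * sin (ang S t)" for t
        by (simp add: lin_def D_def algebra_simps)
      have W_eq: "p * dlin m n S t = m * dlin p q S t + D * trn S t" for t
        by (simp add: dlin_def D_def algebra_simps)
      have bound: "\<bar>p\<bar> * X t \<le> \<bar>m * lin p q S t\<bar> + \<bar>D\<bar>"
        "\<bar>m * lin p q S t\<bar> \<le> \<bar>p\<bar> * X t + \<bar>D\<bar>" if t: "t \<in> pdom S" for t
      proof -
        have "\<bar>\<sigma>\<bar> = 1" using 3(2) by (simp add: power2_eq_1_iff) auto
        then have "X t = \<bar>lin m n S t\<bar>"
          using X(1)[OF t] abs_mult[of \<sigma> "lin m n S t"] by (simp add: X_eq)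
        then have "\<bar>p\<bar> * X t = \<bar>m * lin p q S t + D * sin (ang S t)\<bar>"
          using w_eq[of t] by (simp flip: abs_mult)
        moreover have "\<bar>D * sin (ang S t)\<bar> \<le> \<bar>D\<bar>"
          by (simp add: abs_mult mult_left_le)
        ultimately show "\<bar>p\<bar> * X t \<le> \<bar>m * lin p q S t\<bar> + \<bar>D\<bar>"
          "\<bar>m * lin p q S t\<bar> \<le> \<bar>p\<bar> * X t + \<bar>D\<bar>" by linarith+
      qed
      obtain B where B: "\<And>t. t \<in> pdom S \<Longrightarrow> \<bar>lin p q S t\<bar> \<le> B"
      proof (cases "1 < lam")
        case True
        \<comment> \<open>For \<open>m \<noteq> 0\<close> and \<open>X t \<ge> 1\<close>, the
          superlinear term \<open>\<bar>m * C\<bar> * X t powr lam\<close> is at most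
          \<open>(\<bar>p\<bar> + \<bar>D\<bar>) * X t\<close>, whence
          \<open>X t powr (lam - 1) \<le> L\<close>. The other entries of \<open>K\<close> cover
          \<open>m = 0\<close> and \<open>X t < 1\<close>.\<close>
        define L where "L = (\<bar>p\<bar> + \<bar>D\<bar>) / \<bar>m * C\<bar>"
        define K where "K = max (\<bar>D\<bar> / \<bar>p\<bar>) (max 1 (L powr (1 / (lam - 1))))"
        have XK: "X t \<le> K" if t: "t \<in> pdom S" for t
        proof (cases "m = 0 \<or> X t < 1")
          case m: True
          have "X t \<le> \<bar>D\<bar> / \<bar>p\<bar>" if "m = 0"
            using bound(1)[OF t] False that by (simp add: field_simps)
          with m show ?thesis by (auto simp: K_def)
        next
          case m: False
          have "\<bar>m * C\<bar> * (X t powr (lam - 1) * X t) = \<bar>m * lin p q S t\<bar>"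
            using X(4)[OF t] m by (simp add: abs_mult powr_diff)
          also have "\<dots> \<le> \<bar>p\<bar> * X t + \<bar>D\<bar>" by (rule bound(2)[OF t])
          also have "\<dots> \<le> (\<bar>p\<bar> + \<bar>D\<bar>) * X t"
            using m mult_left_mono[of 1 "X t" "\<bar>D\<bar>"] by (simp add: algebra_simps)
          finally have "(\<bar>m * C\<bar> * X t powr (lam - 1)) * X t \<le> (\<bar>p\<bar> + \<bar>D\<bar>) * X t"
            by (simp only: mult.assoc)
          then have "\<bar>m * C\<bar> * X t powr (lam - 1) \<le> \<bar>p\<bar> + \<bar>D\<bar>"
            by (rule mult_right_le_imp_le) (use m in auto)
          then have "X t powr (lam - 1) \<le> L"
            using m \<open>C \<noteq> 0\<close> by (simp add: L_def pos_le_divide_eq mult.commute)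
          then have "(X t powr (lam - 1)) powr (1 / (lam - 1)) \<le> L powr (1 / (lam - 1))"
            using True by (intro powr_mono2) auto
          then show ?thesis using True X(1)[OF t] by (simp add: powr_powr K_def)
        qed
        have "\<bar>lin p q S t\<bar> \<le> \<bar>C\<bar> * K powr lam" if t: "t \<in> pdom S" for t
          using XK[OF t] X(1)[OF t] True unfolding X(4)[OF t]
          by (simp add: abs_mult mult_left_mono powr_mono2)
        with that show ?thesis by blast
      next
        case neg: False
        then have "lam < 0" "m \<noteq> 0" using lam False by auto
        \<comment> \<open>For \<open>X t \<ge> 1\<close> the negative power is at most 1; for
          smaller \<open>X t\<close> the closeness of \<open>m * u\<close> to \<open>p * w\<close>
          gives the bound.\<close>
        have "\<bar>lin p q S t\<bar> \<le> max \<bar>C\<bar> ((\<bar>p\<bar> + \<bar>D\<bar>) / \<bar>m\<bar>)" if t: "t \<in> pdom S" for t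
        proof (cases "1 \<le> X t")
          case True
          then have "X t powr lam \<le> X t powr 0" using \<open>lam < 0\<close> by (intro powr_mono) auto
          then have "\<bar>lin p q S t\<bar> \<le> \<bar>C\<bar>"
            using True unfolding X(4)[OF t] by (simp add: abs_mult mult_left_le)
          then show ?thesis by simp
        next
          case False
          then have "\<bar>m * lin p q S t\<bar> \<le> \<bar>p\<bar> + \<bar>D\<bar>"
            using bound(2)[OF t] mult_left_mono[of "X t" 1 "\<bar>p\<bar>"] by simp
          then have "\<bar>lin p q S t\<bar> \<le> (\<bar>p\<bar> + \<bar>D\<bar>) / \<bar>m\<bar>"
            using \<open>m \<noteq> 0\<close> by (simp add: field_simps abs_mult)
          then show ?thesis by (rule max.coboundedI2)
        qed
        with that show ?thesis by blast
      qed
      define I where "I = X ` pdom S"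
      \<comment> \<open>\<open>(P, Q)\<close> is the pair \<open>(rho, sin ang)\<close> of the
        translate \<open>S2\<close> as a function of \<open>X t\<close>: \<open>P = u / p\<close>
        and \<open>Q = (p * w - m * u) / D\<close> with \<open>w = \<sigma> * X t\<close>.\<close>
      define P where "P x = C * x powr lam / p" for x
      define P' where "P' x = lam * C * x powr (lam - 1) / p" for x
      define Q where "Q x = (p * \<sigma> * x - m * C * x powr lam) / D" for x
      define Q' where "Q' x = (p * \<sigma> - m * lam * C * x powr (lam - 1)) / D" for x
      have contX: "continuous_on (pdom S) X" unfolding X_def by (rule continuous_lin[OF gen])
      have I: "is_interval I"
        using contX gen_surfaceD(1)[OF gen]
        by (simp add: I_def is_interval_connected_1 connected_continuous_image)
      have I_nontriv: "\<exists>a\<in>I. \<exists>b\<in>I. a < b"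
        unfolding I_def X_def using X(3) \<sigma>
        by (intro lin_not_constant[OF gen trn])
          (auto simp: dlin_def mult.assoc simp flip: distrib_left)
      have I_nn: "I \<subseteq> {0..}" using X(1) by (auto simp: I_def)
      have I0: "1 < lam" if "0 \<in> I" using that X(2) by (auto simp: I_def)
      have dpowr: "((\<lambda>x. x powr lam) has_real_derivative lam * x powr (lam - 1)) (at x within I)"
        if "x \<in> I" for x
        by (rule has_field_derivative_subset[OF powr_has_derivative_nonneg I_nn])
          (use that I_nn I0 in auto)
      have cpowr: "continuous_on I (\<lambda>x. x powr (lam - 1))"
        using I_nn I0 by (intro continuous_on_powr' continuous_intros) force+
      have dP: "(P has_real_derivative P' x) (at x within I)"
        and dQ: "(Q has_real_derivative Q' x) (at x within I)" if "x \<in> I" for x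
        unfolding P_def [abs_def] Q_def [abs_def] P'_def Q'_def
        using DERIV_cdivide[OF DERIV_cmult[OF dpowr[OF that], of C], of p]
          DERIV_cdivide[OF DERIV_diff[OF DERIV_cmult[OF DERIV_ident, of "p * \<sigma>"]
            DERIV_cmult[OF dpowr[OF that], of "m * C"]], of D]
        by (simp_all add: mult_ac)
      have cont': "continuous_on I P'" "continuous_on I Q'"
        unfolding P'_def Q'_def using D False by (intro continuous_intros cpowr; simp)+
      have "0 \<notin> interior I"
        using interior_mono[OF I_nn] by (auto simp: interior_real_atLeast)
      then have int: "(P x, Q x) \<noteq> (0, 0)" if "x \<in> interior I" for x
        using that interior_subset[of I] \<open>C \<noteq> 0\<close> False I_nn by (auto simp: P_def)
      have lamC: "lam * C \<noteq> 0" using lam \<open>C \<noteq> 0\<close> by auto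
      have reg: "(P' x, Q' x) \<noteq> (0, 0)" for x
        using lamC False D \<sigma> by (auto simp: P'_def Q'_def)
      have lift: "rho S2 t = P (X t)" "sin (ang S2 t) = Q (X t)"
        "spd S2 t * Q' (X t) = trn S2 t * P' (X t)" if t: "t \<in> pdom S" for t
      proof -
        have "rho S2 t = lin p q S t / p" using False by (simp add: S2_def lin_def field_simps)
        then show "rho S2 t = P (X t)" using X(4)[OF t] by (simp add: P_def)
        have wX: "\<sigma> * X t = lin m n S t" using \<sigma> by (simp add: X_eq flip: mult.assoc)
        show "sin (ang S2 t) = Q (X t)"
          using w_eq[of t] X(4)[OF t] D unfolding Q_def S2_def
          by (simp add: mult.assoc wX)
        define Z where "Z = lam * C * X t powr (lam - 1)"
        have U: "dlin p q S t = \<sigma> * Z * dlin m n S t" using X(5)[OF t] by (simp add: Z_def mult.assoc)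
        have "spd S2 t = dlin p q S t / p" using False by (simp add: S2_def dlin_def field_simps)
        moreover have "trn S2 t = (p * dlin m n S t - m * dlin p q S t) / D"
          using W_eq[of t] D by (simp add: S2_def)
        moreover have "P' (X t) = Z / p" "Q' (X t) = (p * \<sigma> - m * Z) / D"
          by (simp_all add: P'_def Q'_def Z_def mult.assoc)
        moreover have "dlin p q S t * (p * \<sigma> - m * Z) = (p * dlin m n S t - m * dlin p q S t) * Z"
          unfolding U using \<sigma>(2) by algebra
        ultimately show "spd S2 t * Q' (X t) = trn S2 t * P' (X t)"
          by (simp only: times_divide_times_eq mult.commute[of D p])
      qed
      define A where "A = B / \<bar>p\<bar> + 1"
      have PA: "\<bar>P x\<bar> < A" if x: "x \<in> I" for x
      proof -
        obtain t where t: "t \<in> pdom S" "x = X t" using x by (auto simp: I_def)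
        have "\<bar>P x\<bar> = \<bar>lin p q S t\<bar> / \<bar>p\<bar>" using X(4)[OF t(1)] t(2) by (simp add: P_def)
        also have "\<dots> \<le> B / \<bar>p\<bar>" using B[OF t(1)] by (simp add: divide_right_mono)
        finally show ?thesis by (simp add: A_def)
      qed
      obtain S1 where S1: "elementary S1 S2" "gen_surface S1" "pdom S1 = I"
        "\<And>x. x \<in> I \<Longrightarrow> rho S1 x = Q x / A" "\<And>x. x \<in> I \<Longrightarrow> sin (ang S1 x) = - P x / A"
        "\<And>x. x \<in> I \<Longrightarrow> \<exists>c. c \<noteq> 0 \<and> spd S1 x = c * Q' x \<and> trn S1 x = - c * P' x"
        by (rule reciprocal_preimage[OF S2(1) I I_nontriv, where \<phi> = X and A = A,
              OF _ _ dP cont'(1) dQ cont'(2) reg int PA]) (use contX lift in \<open>auto simp: S2 I_def\<close>)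
      have A0: "0 < A" using PA I_nontriv by fastforce
      \<comment> \<open>This shear cancels the power of \<open>x\<close> in \<open>Q / A\<close>,
        leaving \<open>rho\<close> proportional to \<open>w\<close> and the sine proportional to
        \<open>u\<close>.\<close>
      define T where "T = translate (- m * p / D) S1"
      have T: "gen_surface T" "pdom T = I" using S1 by (simp_all add: T_def gen_surface_translate)
      have T_data: "rho T x = p * \<sigma> * x / (D * A)" "sin (ang T x) = - P x / A"
        "\<exists>c. c \<noteq> 0 \<and> spd T x = c * (p * \<sigma> / D) \<and> trn T x = - c * P' x" if x: "x \<in> I" for x
      proof -
        show "rho T x = p * \<sigma> * x / (D * A)" "sin (ang T x) = - P x / A"
          using A0 D False by (simp_all add: T_def S1(4,5)[OF x] P_def Q_def field_simps)
        obtain c where c: "c \<noteq> 0" "spd S1 x = c * Q' x" "trn S1 x = - c * P' x"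
          using S1(6)[OF x] by blast
        then show "\<exists>c. c \<noteq> 0 \<and> spd T x = c * (p * \<sigma> / D) \<and> trn T x = - c * P' x"
          using D False by (intro exI[of _ c]) (simp add: T_def c P'_def Q'_def field_simps)
      qed
      have "surface_of_revolution T" "\<forall>t\<in>pdom T. curv2 T t = lam * curv1 T t"
      proof -
        have spd: "spd T x \<noteq> 0" if "x \<in> pdom T" for x
          using T_data(3)[of x] that D False \<sigma> by (auto simp: T)
        have pole: "sin (ang T x) = 0 \<and> trn T x = 0" if x: "x \<in> pdom T" "rho T x = 0" for x
        proof -
          have "x = 0" using x T_data(1)[of x] D False \<sigma> A0 by (simp add: T)
          then show ?thesis using T_data[of x] x by (auto simp: T P_def P'_def)
        qed
        have weing: "trn T x * rho T x = lam * spd T x * sin (ang T x)" if "x \<in> pdom T" for x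
        proof -
          have x: "x \<in> I" using that T by simp
          have xx: "x powr lam = x powr (lam - 1) * x" using x I_nn by (cases "x = 0") (auto simp: powr_diff)
          obtain c where c: "spd T x = c * (p * \<sigma> / D)" "trn T x = - c * P' x"
            using T_data(3)[OF x] by blast
          show ?thesis using D False A0
            by (simp add: c T_data(1,2)[OF x] P_def P'_def xx field_simps)
        qed
        show "surface_of_revolution T" "\<forall>t\<in>pdom T. curv2 T t = lam * curv1 T t"
          using weingarten_surfaceI[OF T(1) spd pole weing] by blast+
      qed
      moreover have "image_under_composition T S"
        using elementary_imp_image[OF _ S1(1)] elementary_translate(1)[OF S1(2)]
          elementary_translate(1)[OF gen] by (simp add: T_def S2_def)
      ultimately show ?thesis by blast
    qed
  qed
qed

section \<open>Degenerate relations with one vanishing coefficient\<close>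

text \<open>Where \<open>U \<noteq> 0\<close> the form \<open>lin m n S\<close> vanishes nearby,
  hence so does its derivative; cancelling the cosine gives \<open>U * W = 0\<close> everywhere. As
  \<open>U\<close> and \<open>W\<close> never vanish together, \<open>U\<^sup>2 - W\<^sup>2\<close>
  has constant sign, which selects one alternative.\<close>

lemma parabolic_dichotomy:
  assumes S: "gen_surface S" "\<And>t. t \<in> pdom S \<Longrightarrow> trn S t \<noteq> 0"
    and det: "p * n - q * m \<noteq> 0"
    and rel: "\<And>t. t \<in> pdom S \<Longrightarrow> lin m n S t * dlin p q S t = 0"
  shows "(\<forall>t\<in>pdom S. dlin p q S t = 0) \<or> (\<forall>t\<in>pdom S. dlin m n S t = 0)"
proof -
  define U W where "U = dlin p q S" and "W = dlin m n S"
  have cont: "continuous_on (pdom S) U" "continuous_on (pdom S) W"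
    unfolding U_def W_def by (rule continuous_dlin[OF S(1)])+
  have UW: "U t \<noteq> 0 \<or> W t \<noteq> 0" if "t \<in> pdom S" for t
    using linear_forms_zero[OF det, of "spd S t" "trn S t"] S(2)[OF that]
    by (auto simp: U_def W_def dlin_def)
  have "(U t * W t) * cos (ang S t) = 0" if t: "t \<in> interior (pdom S)" for t
  proof (cases "U t = 0")
    case False
    have tp: "t \<in> pdom S" using t interior_subset by blast
    have "isCont U t" using cont(1) t continuous_on_interior by blast
    then have "\<forall>\<^sub>F r in nhds t. U r \<noteq> 0"
      using False by (auto simp: isCont_def tendsto_imp_eventually_ne eventually_nhds_conv_at)
    moreover have "\<forall>\<^sub>F r in nhds t. r \<in> interior (pdom S)"
      using t by (simp add: eventually_nhds_in_open)
    ultimately have "\<forall>\<^sub>F r in nhds t. lin m n S r = 0"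
    proof eventually_elim
      case (elim r)
      then show ?case using rel[of r] interior_subset[of "pdom S"] by (auto simp: U_def)
    qed
    then have "(lin m n S has_real_derivative 0) (at t)"
      by (subst DERIV_cong_ev[OF refl _ refl]) auto
    moreover have "(lin m n S has_real_derivative W t * cos (ang S t)) (at t)"
      using lin_has_derivative[OF S(1) tp] t at_within_interior unfolding W_def by metis
    ultimately have "W t * cos (ang S t) = 0" using DERIV_unique by blast
    then show ?thesis by simp
  qed simp
  moreover have "continuous_on (pdom S) (\<lambda>t. U t * W t)"
    by (intro continuous_intros cont)
  ultimately have zero: "U t * W t = 0" if "t \<in> pdom S" for t
    using cos_ang_factor_zero[OF S _ _ that] by blast
  have "continuous_on (pdom S) (\<lambda>t. (U t)\<^sup>2 - (W t)\<^sup>2)"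
    by (intro continuous_intros cont)
  moreover have "(U t)\<^sup>2 - (W t)\<^sup>2 \<noteq> 0" if "t \<in> pdom S" for t
  proof (cases "U t = 0")
    case False
    then show ?thesis using zero[OF that] by simp
  qed (use UW[OF that] in simp)
  ultimately have "(\<forall>t\<in>pdom S. 0 < (U t)\<^sup>2 - (W t)\<^sup>2) \<or> (\<forall>t\<in>pdom S. (U t)\<^sup>2 - (W t)\<^sup>2 < 0)"
    using continuous_nonzero_sign[OF gen_surfaceD(1)[OF S(1)]] by blast
  then show ?thesis
  proof
    assume pos: "\<forall>t\<in>pdom S. 0 < (U t)\<^sup>2 - (W t)\<^sup>2"
    have "W t = 0" if "t \<in> pdom S" for t
      using pos[rule_format, OF that] zero[OF that] by (cases "U t = 0") auto
    then show ?thesis by (simp add: W_def)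
  next
    assume neg: "\<forall>t\<in>pdom S. (U t)\<^sup>2 - (W t)\<^sup>2 < 0"
    have "U t = 0" if "t \<in> pdom S" for t
      using neg[rule_format, OF that] zero[OF that] by (cases "W t = 0") auto
    then show ?thesis by (simp add: U_def)
  qed
qed

text \<open>Either alternative of the dichotomy makes the second radius constant: the coefficient of
  \<open>spd\<close> is nonzero because \<open>trn\<close> is, so the form can be scaled to
  \<open>dlin 1 v\<close>.\<close>

lemma parabolic_image:
  assumes S: "surface_of_revolution S" "non_flat S"
    and det: "p * n - q * m \<noteq> 0"
    and rel: "\<And>t. t \<in> pdom S \<Longrightarrow> lin m n S t * dlin p q S t = 0"
  shows "\<exists>T. surface_of_revolution T \<and> (\<forall>t\<in>pdom T. curv2 T t = 0 * curv1 T t) \<and>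
    image_under_composition T S"
proof -
  have gen: "gen_surface S" using S by (simp add: surface_of_revolution_def)
  note trn = non_flatD(2)[OF S]
  have main: ?thesis
    if U: "\<forall>t\<in>pdom S. dlin a b S t = 0" and ab: "a \<noteq> 0 \<or> b \<noteq> 0" for a b
  proof -
    obtain t0 where t0: "t0 \<in> pdom S" using gen_surfaceD(2)[OF gen] by blast
    then have "a \<noteq> 0" using U ab trn[OF t0] by (auto simp: dlin_def)
    moreover have "a * dlin 1 (b / a) S t = dlin a b S t" for t
      using \<open>a \<noteq> 0\<close> by (simp add: dlin_def field_simps)
    ultimately have "dlin 1 (b / a) S t = 0" if "t \<in> pdom S" for t
      using U that by (metis mult_eq_0_iff)
    then show ?thesis using constant_radius2_image[OF S, of "b / a" 0] by blast
  qed
  have "p \<noteq> 0 \<or> q \<noteq> 0" "m \<noteq> 0 \<or> n \<noteq> 0" using det by auto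
  with parabolic_dichotomy[OF gen trn det rel] show ?thesis
    using main by blast
qed

text \<open>
  \<open>\<Lambda>\<^sub>2\<close> is the discriminant of the symmetric part of the Weingarten relation, seen as a
  bilinear form in the two radii. So \<open>\<Lambda>\<^sub>2 > 0\<close> provides two real isotropic lines, in whose
  coordinates the form becomes antidiagonal.
\<close>

lemma isotropic_factorization:
  assumes "Lambda2 \<alpha> \<beta> \<gamma> \<delta> > 0"
  obtains p q m n \<kappa>1 \<kappa>2 where "p * n - q * m \<noteq> 0" "\<kappa>1 + \<kappa>2 \<noteq> 0"
    "\<delta> = (\<kappa>1 + \<kappa>2) * m * p" "\<alpha> = (\<kappa>1 + \<kappa>2) * n * q"
    "\<beta> = \<kappa>1 * n * p + \<kappa>2 * q * m" "\<gamma> = \<kappa>1 * m * q + \<kappa>2 * p * n"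
proof (cases "\<delta> = 0")
  case True
  then have "\<gamma> + \<beta> \<noteq> 0" using assms by (auto simp: Lambda2_def add.commute)
  \<comment> \<open>Here \<open>u = sin ang\<close> and
    \<open>w = rho + \<alpha> / (\<gamma> + \<beta>) * sin ang\<close>; without \<delta> the
    horizontal direction is already isotropic.\<close>
  then show ?thesis using True that[of 0 "\<alpha> / (\<gamma> + \<beta>)" 1 1 \<gamma> \<beta>] by simp
next
  case False
  define R where "R = sqrt (Lambda2 \<alpha> \<beta> \<gamma> \<delta>)"
  have R: "R > 0" "R * R = (\<beta> + \<gamma>)\<^sup>2 - 4 * \<alpha> * \<delta>" using assms by (simp_all add: R_def Lambda2_def)
  \<comment> \<open>The roots of
    \<open>\<delta> * x\<^sup>2 - (\<beta> + \<gamma>) * x + \<alpha>\<close>, distinct because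
    \<Lambda>2 is positive; \<open>p\<close> and \<open>m\<close> will be 1.\<close>
  define q n where "q = (\<beta> + \<gamma> - R) / (2 * \<delta>)" and "n = (\<beta> + \<gamma> + R) / (2 * \<delta>)"
  have nq: "\<delta> * (n - q) = R" "\<delta> * (n + q) = \<beta> + \<gamma>"
    using False by (simp_all add: q_def n_def field_simps)
  have "\<delta> * (\<delta> * n * q) = \<delta> * \<alpha>"
  proof -
    have "4 * (\<delta> * (\<delta> * n * q)) = (\<delta> * (n + q))\<^sup>2 - (\<delta> * (n - q)) * (\<delta> * (n - q))" by algebra
    also have "\<dots> = 4 * (\<delta> * \<alpha>)" unfolding nq R(2) by algebra
    finally show ?thesis by simp
  qed
  then have \<alpha>: "\<alpha> = \<delta> * n * q" using False by simp
  have "n - q \<noteq> 0" using nq(1) R(1) by auto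
  \<comment> \<open>The solution of \<open>\<beta> = \<kappa>1 * n + \<kappa>2 * q\<close> with
    \<open>\<kappa>1 + \<kappa>2 = \<delta>\<close>.\<close>
  define \<kappa>1 where "\<kappa>1 = (\<beta> - \<delta> * q) / (n - q)"
  have \<kappa>1: "\<kappa>1 * (n - q) = \<beta> - \<delta> * q" using \<open>n - q \<noteq> 0\<close> by (simp add: \<kappa>1_def)
  have "\<beta> = \<kappa>1 * n + (\<delta> - \<kappa>1) * q" using \<kappa>1 by algebra
  moreover have "\<gamma> = \<kappa>1 * q + (\<delta> - \<kappa>1) * n" using \<kappa>1 nq(2) by algebra
  ultimately show ?thesis
    using \<open>n - q \<noteq> 0\<close> False \<alpha> that[of 1 n q 1 \<kappa>1 "\<delta> - \<kappa>1"] by simp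
qed

theorem theorem4p28:
  fixes S :: profile and \<alpha> \<beta> \<gamma> \<delta> :: real
  assumes "surface_of_revolution S"
    and "non_flat S"
    and "semi_quadratic \<alpha> \<beta> \<gamma> \<delta> S"
    and "Lambda2 \<alpha> \<beta> \<gamma> \<delta> > 0"
  shows "\<exists>(T :: profile) (lam :: real).
           surface_of_revolution T \<and>
           (\<forall>t\<in>pdom T. curv2 T t = lam * curv1 T t) \<and>
           image_under_composition T S \<and>
           (elliptic \<alpha> \<beta> \<gamma> \<delta> \<longrightarrow> lam < 0) \<and>
           (hyperbolic \<alpha> \<beta> \<gamma> \<delta> \<longrightarrow> lam > 0)"
proof -
  note S = assms(1,2)
  obtain p q m n \<kappa>1 \<kappa>2 where det: "p * n - q * m \<noteq> 0" and sum: "\<kappa>1 + \<kappa>2 \<noteq> 0"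
    and coeffs: "\<delta> = (\<kappa>1 + \<kappa>2) * m * p" "\<alpha> = (\<kappa>1 + \<kappa>2) * n * q"
      "\<beta> = \<kappa>1 * n * p + \<kappa>2 * q * m" "\<gamma> = \<kappa>1 * m * q + \<kappa>2 * p * n"
    using isotropic_factorization[OF assms(4)] by metis
  have det': "m * q - n * p \<noteq> 0" using det by (simp add: algebra_simps)
  have rel: "\<kappa>1 * lin m n S t * dlin p q S t + \<kappa>2 * lin p q S t * dlin m n S t = 0"
    if t: "t \<in> pdom S" for t
  proof (cases "rho S t = 0 \<and> sin (ang S t) = 0")
    \<comment> \<open>At a pole both linear forms vanish and the relation is empty; what is needed
      there is recovered by continuity.\<close>
    case True
    then show ?thesis by (simp add: lin_def)
  next
    case False
    then have "rho S t \<noteq> 0" "spd S t \<noteq> 0"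
      using non_flatD[OF S t] by auto
    moreover have "\<alpha> * curv1 S t * curv2 S t + \<beta> * curv1 S t + \<gamma> * curv2 S t + \<delta> = 0"
      using assms(3) t by (simp add: semi_quadratic_def)
    ultimately have "\<alpha> * sin (ang S t) * trn S t + \<beta> * sin (ang S t) * spd S t
        + \<gamma> * rho S t * trn S t + \<delta> * rho S t * spd S t = 0"
      using False by (simp add: curv1_def curv2_def radius1_def radius2_def field_simps)
    then show ?thesis unfolding coeffs lin_def dlin_def by algebra
  qed
  have rel': "\<kappa>2 * lin p q S t * dlin m n S t + \<kappa>1 * lin m n S t * dlin p q S t = 0"
    if "t \<in> pdom S" for t using rel[OF that] by simp
  \<comment> \<open>The left side is \<open>4 * (\<beta> * \<gamma> - \<alpha> * \<delta>)\<close>,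
    a determinant of the bilinear form, so the sign of \<open>\<kappa>1 * \<kappa>2\<close> decides
    the type.\<close>
  have disc: "Lambda2 \<alpha> \<beta> \<gamma> \<delta> - (Lambda1 \<beta> \<gamma>)\<^sup>2 = 4 * (\<kappa>1 * \<kappa>2) * (p * n - q * m)\<^sup>2"
    unfolding Lambda1_def Lambda2_def coeffs by algebra
  have sq: "0 < (p * n - q * m)\<^sup>2" using det by simp
  have types: "elliptic \<alpha> \<beta> \<gamma> \<delta> \<longleftrightarrow> 0 < \<kappa>1 * \<kappa>2" "hyperbolic \<alpha> \<beta> \<gamma> \<delta> \<longleftrightarrow> \<kappa>1 * \<kappa>2 < 0"
  proof -
    have "elliptic \<alpha> \<beta> \<gamma> \<delta> \<longleftrightarrow> 0 < 4 * (\<kappa>1 * \<kappa>2) * (p * n - q * m)\<^sup>2"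
      "hyperbolic \<alpha> \<beta> \<gamma> \<delta> \<longleftrightarrow> 4 * (\<kappa>1 * \<kappa>2) * (p * n - q * m)\<^sup>2 < 0"
      unfolding disc[symmetric] elliptic_def hyperbolic_def by auto
    with sq show "elliptic \<alpha> \<beta> \<gamma> \<delta> \<longleftrightarrow> 0 < \<kappa>1 * \<kappa>2" "hyperbolic \<alpha> \<beta> \<gamma> \<delta> \<longleftrightarrow> \<kappa>1 * \<kappa>2 < 0"
      by (auto simp: zero_less_mult_iff mult_less_0_iff)
  qed
  consider (parabolic) "\<kappa>1 * \<kappa>2 = 0" | (elliptic) "0 < \<kappa>1 * \<kappa>2" | (hyperbolic) "\<kappa>1 * \<kappa>2 < 0"
    by linarith
  then show ?thesis
  proof cases
    case parabolic
    have "\<exists>T. surface_of_revolution T \<and> (\<forall>t\<in>pdom T. curv2 T t = 0 * curv1 T t) \<and>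
        image_under_composition T S"
    proof (cases "\<kappa>2 = 0")
      case True
      then show ?thesis using parabolic_image[OF S det] rel sum by simp
    next
      case False
      then show ?thesis using parabolic_image[OF S det'] rel parabolic by simp
    qed
    \<comment> \<open>Neither type occurs, so \<open>lam = 0\<close> violates no sign
      condition.\<close>
    with parabolic types show ?thesis by (metis less_irrefl)
  next
    case elliptic
    then have \<kappa>: "\<kappa>1 \<noteq> 0" "\<kappa>2 \<noteq> 0" by auto
    have neg: "- \<kappa>2 / \<kappa>1 < 0" "- \<kappa>1 / \<kappa>2 < 0"
      using elliptic by (auto simp: zero_less_mult_iff zero_less_divide_iff)
    show ?thesis
    \<comment> \<open>Exchanging \<open>u\<close> and \<open>w\<close> keeps \<open>lam\<close>
      negative and moves the vanishing coefficient \<open>m\<close> into the place of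
      \<open>p\<close>.\<close>
    proof (cases "m = 0")
      case True
      then show ?thesis
        using nonparabolic_image[OF S det' \<kappa>(2,1) refl _ rel'] neg elliptic types by (meson less_asym)
    next
      case False
      then show ?thesis
        using nonparabolic_image[OF S det \<kappa> refl _ rel] neg elliptic types by (meson less_asym)
    qed
  next
    case hyperbolic
    then have \<kappa>: "\<kappa>1 \<noteq> 0" "\<kappa>2 \<noteq> 0" by auto
    \<comment> \<open>The two quotients are positive and mutually inverse, and differ from 1 because
      \<open>\<kappa>1 + \<kappa>2 \<noteq> 0\<close>.\<close>
    have "1 < - \<kappa>2 / \<kappa>1 \<or> 1 < - \<kappa>1 / \<kappa>2"
      using hyperbolic sum by (auto simp: mult_less_0_iff divide_less_eq)
    then show ?thesis
    proof
      assume lam: "1 < - \<kappa>2 / \<kappa>1"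
      then have "0 < - \<kappa>2 / \<kappa>1" by linarith
      with lam show ?thesis
        using nonparabolic_image[OF S det \<kappa> refl _ rel] hyperbolic types by (meson less_asym)
    next
      assume lam: "1 < - \<kappa>1 / \<kappa>2"
      then have "0 < - \<kappa>1 / \<kappa>2" by linarith
      with lam show ?thesis
        using nonparabolic_image[OF S det' \<kappa>(2,1) refl _ rel'] hyperbolic types by (meson less_asym)
    qed
  qed
qed

end
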